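(* Let $f\in\mathcal{K}_S$, with logarithmic coefficients $\gamma_n=\gamma_n(f)$, and let $H_{2,2}(F_f/2)=\gamma_2\gamma_4-\gamma_3^2$. Then $$|H_{2,2}(F_f/2)|\le \frac{13}{1080}.$$ The inequality is sharp, i.e. there exists a function $f\in\mathcal{K}_S$ for which equality holds.
   Context: Let $\mathbb{D}=\{z\in\mathbb{C}:|z|<1\}$ and let $\mathcal{A}$ be the class of functions $f$ holomorphic in $\mathbb{D}$ with $f(0)=0$ and $f'(0)=1$, so $f(z)=z+\sum_{n=2}^\infty a_nz^n$. The class $\mathcal{K}_S$ of functions convex with respect to symmetric points consists of all $f\in\mathcal{A}$ such that $$\mathrm{Re}\left(\frac{(zf'(z))'}{(f(z)-f(-z))'}\right)>0,\qquad z\in\mathbb{D},$$ where $(f(z)-f(-z))'$ is the derivative of $z\mapsto f(z)-f(-z)$, i.e. $f'(z)+f'(-z)$. Functions in this class are univalent, so $f(z)/z$ does not vanish in $\mathbb{D}$ and the logarithmic coefficients $\gamma_n=\gamma_n(f)$ are defined by $$F_f(z):=\log\frac{f(z)}{z}=2\sum_{n=1}^\infty\gamma_n(f)z^n,\qquad z\in\mathbb{D},\quad \log 1:=0.$$ The second Hankel determinant of logarithmic coefficients is $$H_{2,2}(F_f/2)=\begin{vmatrix}\gamma_2&\gamma_3\\ \gamma_3&\gamma_4\end{vmatrix}=\gamma_2\gamma_4-\gamma_3^2.$$ *)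

theory Defs
  imports "HOL-Complex_Analysis.Complex_Analysis"
begin

abbreviation unit_disc :: "complex set" ("\<bbbD>") where
  "\<bbbD> \<equiv> ball 0 1"

definition class_A :: "(complex \<Rightarrow> complex) set" where
  "class_A = {f. f holomorphic_on \<bbbD> \<and> f 0 = 0 \<and> deriv f 0 = 1}"

text \<open>Since \<open>x / 0 = 0\<close>, positivity of the real part forces the denominator
  \<open>f'(z) + f'(-z)\<close> to be nonzero throughout the disc.\<close>

definition class_K_S :: "(complex \<Rightarrow> complex) set" where
  "class_K_S = {f \<in> class_A. \<forall>z\<in>\<bbbD>.
     Re (deriv (\<lambda>w. w * deriv f w) z / deriv (\<lambda>w. f w - f (- w)) z) > 0}"

text \<open>The holomorphic branch of \<open>log (f(z)/z)\<close> on the whole disc vanishing at \<open>0\<close>.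
  At \<open>0\<close> the quotient is understood as its limit \<open>f'(0) = 1\<close>. The branch is unique
  on \<open>\<bbbD>\<close> (so the choice below only affects irrelevant values outside), and it exists
  whenever \<open>f(z)/z\<close> has no zeros in \<open>\<bbbD>\<close>, in particular for univalent \<open>f \<in> class_A\<close>.
  It is in general not the principal logarithm \<open>Ln\<close>.\<close>

definition is_log_quotient :: "(complex \<Rightarrow> complex) \<Rightarrow> (complex \<Rightarrow> complex) \<Rightarrow> bool" where
  "is_log_quotient f F \<longleftrightarrow>
     F holomorphic_on \<bbbD> \<and> F 0 = 0 \<and> (\<forall>z\<in>\<bbbD> - {0}. exp (F z) = f z / z)"

definition log_quotient :: "(complex \<Rightarrow> complex) \<Rightarrow> complex \<Rightarrow> complex" where
  "log_quotient f = (SOME F. is_log_quotient f F)"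

text \<open>The logarithmic coefficients: \<open>log (f(z)/z) = 2 * (\<Sum>n\<ge>1. log_coeff f n * z ^ n)\<close>.\<close>

definition log_coeff :: "(complex \<Rightarrow> complex) \<Rightarrow> nat \<Rightarrow> complex" where
  "log_coeff f n = fps_nth (fps_expansion (log_quotient f) 0) n / 2"

text \<open>The second Hankel determinant with rows \<open>(\<gamma>\<^sub>2, \<gamma>\<^sub>3)\<close> and \<open>(\<gamma>\<^sub>3, \<gamma>\<^sub>4)\<close>.\<close>

definition hankel_log_2_2 :: "(complex \<Rightarrow> complex) \<Rightarrow> complex" where
  "hankel_log_2_2 f = log_coeff f 2 * log_coeff f 4 - (log_coeff f 3)\<^sup>2"

end

theory Submission
  imports Defs
begin

text \<open>
  Write \<open>p(z) = 2 (z f'(z))' / (f(z) - f(-z))'\<close>, a function with positive real part and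
  \<open>p(0) = 1\<close>. Its Cayley transform \<open>(p - 1) / (p + 1)\<close> has the form \<open>z \<phi>(z)\<close> with
  \<open>|\<phi>| \<le> 1\<close>, and comparing Taylor coefficients turns \<open>4 (\<gamma>\<^sub>2 \<gamma>\<^sub>4 - \<gamma>\<^sub>3\<^sup>2)\<close> into a polynomial in
  the first four coefficients of \<open>\<phi>\<close> (\<open>hankel_log_2_2_eq_hankel_schwarz\<close>). Three steps of the
  Schur algorithm parametrise these coefficients by four numbers \<open>a, b, c, d\<close> of the closed unit
  disc (\<open>bounded_coefficients\<close>).

  In these parameters the polynomial, collected by powers of \<open>c\<close> and \<open>d\<close>, has within each group
  coefficients of one sign as soon as \<open>1 - |a|\<^sup>2\<close> and \<open>1 - |b|\<^sup>2\<close> are kept as factors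
  (\<open>hankel_schwarz_schur_form\<close>). The triangle inequality, applied monomial by monomial, therefore
  loses little: it leaves a polynomial in \<open>|a|\<close> and \<open>|b|\<close> on the unit square, whose maximum
  \<open>13/270\<close> is attained at \<open>|a| = 0\<close>, \<open>|b| = 1\<close> (\<open>schur_majorant_le\<close>). For \<open>a = 0\<close> and \<open>b = 1\<close> one has
  \<open>\<phi>(z) = z\<close>, that is \<open>p(z) = (1 + z\<^sup>2) / (1 - z\<^sup>2)\<close>, and \<open>f\<close> is the inverse hyperbolic tangent, whose
  coefficients give equality.

  The logarithmic coefficients only make sense once \<open>f(z) / z\<close> is known to have no zero. This is
  deduced from \<open>boundary_contact\<close>: where the real part of a holomorphic \<open>q\<close> first vanishes on
  growing circles, \<open>z q'(z)\<close> is real and nonpositive. The consequences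
  \<open>convex_imp_quotient_form\<close> and \<open>quotient_from_derivatives\<close> say that convex functions are starlike
  and that positivity of the real part passes from a quotient of derivatives to the quotient of the
  functions. Used twice each, they compare first \<open>z f'(z)\<close> with the convex function
  \<open>g(z) = f(z) - f(-z)\<close>, and then \<open>f\<close> with the primitive of \<open>g(z) / z\<close>, which is convex and
  vanishes only at the origin (\<open>class_K_S_nonzero\<close>).
\<close>

section \<open>Quotients of holomorphic functions with positive real part\<close>

text \<open>A point \<open>z0\<close> of least modulus with \<open>Re (q z0) \<le> 0\<close> does the job. Every direction \<open>z0 h\<close> with
  \<open>Re h < 0\<close> leads from \<open>z0\<close> into the smaller disc, where \<open>Re q > 0\<close>, so the derivative
  \<open>Re (z0 q'(z0) h)\<close> of \<open>Re q\<close> in that direction cannot be negative. A linear functional that is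
  nonnegative on a half-plane is a nonpositive real multiple of \<open>h \<mapsto> Re h\<close>.\<close>

lemma boundary_contact:
  fixes q :: "complex \<Rightarrow> complex"
  assumes q: "q holomorphic_on \<bbbD>" and q0: "0 < Re (q 0)"
    and z1: "z1 \<in> \<bbbD>" "Re (q z1) \<le> 0"
  obtains z0 where "z0 \<in> \<bbbD>" "Re (q z0) = 0"
    "Im (z0 * deriv q z0) = 0" "Re (z0 * deriv q z0) \<le> 0"
proof -
  let ?K = "cball 0 (norm z1)"
  define S where "S = ?K \<inter> (\<lambda>z. Re (q z)) -` {..0}"
  have sub: "?K \<subseteq> \<bbbD>" using z1 by auto
  have "continuous_on ?K (\<lambda>z. Re (q z))"
    using q sub by (intro continuous_intros holomorphic_on_imp_continuous_on) (rule holomorphic_on_subset)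
  then have "closed S"
    unfolding S_def by (intro continuous_closed_preimage) auto
  then have "compact S"
    unfolding S_def using bounded_subset[OF bounded_cball] by (auto simp: compact_eq_bounded_closed)
  moreover have "z1 \<in> S" using z1 by (simp add: S_def)
  ultimately obtain z0 where z0S: "z0 \<in> S" and z0min: "\<And>z. z \<in> S \<Longrightarrow> norm z0 \<le> norm z"
    using continuous_attains_inf[of S norm] by (auto intro: continuous_intros)
  have z0D: "z0 \<in> \<bbbD>" and z0le: "norm z0 \<le> norm z1" and Rez0: "Re (q z0) \<le> 0"
    using z0S sub by (auto simp: S_def)
  have z0nz: "z0 \<noteq> 0" using q0 Rez0 by auto
  have inside: "0 < Re (q z)" if "norm z < norm z0" for z
    using z0min[of z] that z0le by (force simp: S_def)
  define w where "w = z0 * deriv q z0"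
  have der: "((\<lambda>t. Re (q (z0 + of_real t * (z0 * h)))) has_real_derivative Re (w * h)) (at 0)" for h
  proof -
    have "(q has_field_derivative deriv q z0) (at z0)"
      by (rule holomorphic_derivI[OF q open_ball z0D])
    then have "(q has_field_derivative deriv q z0) (at (z0 + of_real 0 * (z0 * h)))" by simp
    then have "((\<lambda>t. q (z0 + of_real t * (z0 * h))) has_vector_derivative (z0 * h) * deriv q z0) (at 0)"
      by (rule field_vector_diff_chain_at[rotated, unfolded o_def])
         (auto intro!: derivative_eq_intros)
    then have "((\<lambda>t. Re (q (z0 + of_real t * (z0 * h)))) has_real_derivative Re ((z0 * h) * deriv q z0)) (at 0)"
      by (rule has_field_derivative_Re)
    then show ?thesis by (simp add: w_def mult_ac)
  qed
  have short: "norm (z0 + of_real t * (z0 * h)) < norm z0"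
    if "0 < t" "t * (norm h)\<^sup>2 < - 2 * Re h" for t h
  proof -
    have "(norm (1 + of_real t * h))\<^sup>2 = 1 + t * (2 * Re h + t * (norm h)\<^sup>2)"
      unfolding cmod_power2 by (simp add: algebra_simps power2_eq_square)
    also have "\<dots> < 1" using that by (simp add: mult_pos_neg)
    finally have "norm (1 + of_real t * h) < 1" by (simp add: power_less_one_iff)
    moreover have "z0 + of_real t * (z0 * h) = z0 * (1 + of_real t * h)" by (simp add: algebra_simps)
    ultimately show ?thesis using z0nz by (simp add: norm_mult)
  qed
  have small: "\<exists>t>0. t < d \<and> t * (norm h)\<^sup>2 < - 2 * Re h" if "d > 0" "Re h < 0" for d h
  proof -
    have "norm h > 0" using that by auto
    then show ?thesis using that
      by (intro exI[of _ "min (d/2) (- Re h / (norm h)\<^sup>2)"]) (auto simp: min_def field_simps)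
  qed
  have Rez0': "Re (q z0) = 0"
  proof (rule ccontr)
    assume "Re (q z0) \<noteq> 0"
    then have neg: "Re (q z0) < 0" using Rez0 by simp
    have "isCont (\<lambda>t. Re (q (z0 + of_real t * (z0 * (-1))))) 0"
      using der[of "-1"] DERIV_isCont by blast
    then have "eventually (\<lambda>t. Re (q (z0 + of_real t * (z0 * (-1)))) < 0) (at 0)"
      using neg by (intro order_tendstoD(2)[of _ "Re (q z0)"]) (auto simp: isCont_def)
    then obtain d where d: "d > 0" "\<And>t. t \<noteq> 0 \<Longrightarrow> \<bar>t\<bar> < d \<Longrightarrow> Re (q (z0 + of_real t * (z0 * (-1)))) < 0"
      by (auto simp: eventually_at)
    obtain t where t: "t > 0" "t < d" "t * (norm (-1::complex))\<^sup>2 < - 2 * Re (-1)"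
      using small[OF d(1), of "-1"] by auto
    show False using inside[OF short[OF t(1,3)]] d(2)[of t] t by auto
  qed
  have key: "0 \<le> Re (w * h)" if hneg: "Re h < 0" for h
  proof (rule ccontr)
    assume "\<not> 0 \<le> Re (w * h)"
    then obtain d where d: "d > 0" "\<And>t. t > 0 \<Longrightarrow> t < d \<Longrightarrow> Re (q (z0 + of_real t * (z0 * h))) < 0"
      using DERIV_neg_dec_right[OF der[of h]] Rez0' by auto
    obtain t where t: "t > 0" "t < d" "t * (norm h)\<^sup>2 < - 2 * Re h" using small[OF d(1) hneg] by auto
    show False using inside[OF short[OF t(1,3)]] d(2)[OF t(1,2)] by simp
  qed
  have "Re w \<le> 0" using key[of "-1"] by simp
  moreover have "Im w = 0"
  proof (rule ccontr)
    assume nz: "Im w \<noteq> 0"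
    \<comment> \<open>\<open>e\<close> is small enough for the direction \<open>-e + i sgn (Im w)\<close>, nearly tangential to the circle,
      to contradict \<open>key\<close>.\<close>
    define e where "e = \<bar>Im w\<bar> / (2 * (1 + \<bar>Re w\<bar>))"
    have "e > 0" using nz by (simp add: e_def)
    have "2 * e + 2 * (e * \<bar>Re w\<bar>) = \<bar>Im w\<bar>"
    proof -
      have "1 + \<bar>Re w\<bar> \<noteq> 0" by linarith
      then have "2 * (1 + \<bar>Re w\<bar>) * e = \<bar>Im w\<bar>" unfolding e_def by simp
      then show ?thesis by (simp add: algebra_simps)
    qed
    moreover have "0 \<le> e * \<bar>Re w\<bar>" using \<open>e > 0\<close> by simp
    ultimately have "e * \<bar>Re w\<bar> < \<bar>Im w\<bar>" using \<open>e > 0\<close> by linarith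
    moreover have "0 \<le> - e * Re w - sgn (Im w) * Im w"
      using key[of "Complex (-e) (sgn (Im w))"] \<open>e > 0\<close> by (simp add: algebra_simps)
    moreover have "- e * Re w \<le> e * \<bar>Re w\<bar>"
      using \<open>e > 0\<close> mult_left_mono[of "- Re w" "\<bar>Re w\<bar>" e] by simp
    moreover have "sgn (Im w) * Im w = \<bar>Im w\<bar>" by (simp add: abs_sgn mult.commute)
    ultimately show False by linarith
  qed
  ultimately show ?thesis using that[OF z0D Rez0'] by (simp add: w_def)
qed

text \<open>Convex functions are starlike: for \<open>l(z) = D(z) / (z D'(z))\<close> the claim is that \<open>Re l > 0\<close>.
  Working with this quotient instead of its reciprocal keeps everything holomorphic before
  \<open>D\<close> is known to vanish only at the origin. Differentiating \<open>D = l z D'\<close> gives \<open>1 - z l' = l P\<close>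
  with \<open>P = (z D')' / D'\<close>. At a contact point \<open>l\<close> is purely imaginary and the left-hand side is
  a real number \<open>\<ge> 1\<close>, which would make \<open>P\<close> purely imaginary.\<close>

lemma convex_imp_quotient_form:
  assumes D: "D holomorphic_on \<bbbD>" "D 0 = 0" and nz: "\<And>z. z \<in> \<bbbD> \<Longrightarrow> deriv D z \<noteq> 0"
    and P: "\<And>z. z \<in> \<bbbD> \<Longrightarrow> 0 < Re ((deriv D z + z * deriv (deriv D) z) / deriv D z)"
  obtains l where "l holomorphic_on \<bbbD>" "\<And>z. z \<in> \<bbbD> \<Longrightarrow> D z = l z * (z * deriv D z)"
    "\<And>z. z \<in> \<bbbD> \<Longrightarrow> 0 < Re (l z)"
proof -
  obtain d where d: "d holomorphic_on \<bbbD>" "\<And>z. norm z < 1 \<Longrightarrow> D z = z * d z" "deriv D 0 = d 0"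
    using Schwarz3[OF D] by blast
  have D': "deriv D holomorphic_on \<bbbD>" by (intro holomorphic_deriv D) auto
  define l where "l = (\<lambda>z. d z / deriv D z)"
  have l: "l holomorphic_on \<bbbD>" unfolding l_def by (intro holomorphic_intros d D' nz)
  have eq: "D z = l z * (z * deriv D z)" if "z \<in> \<bbbD>" for z
    using d(2)[of z] nz[of z] that by (simp add: l_def)
  have "0 < Re (l z)" if z: "z \<in> \<bbbD>" for z
  proof (rule ccontr)
    assume "\<not> 0 < Re (l z)"
    moreover have "l 0 = 1" using nz[of 0] d(3) by (simp add: l_def)
    ultimately obtain z0 where z0: "z0 \<in> \<bbbD>" "Re (l z0) = 0" "Im (z0 * deriv l z0) = 0" "Re (z0 * deriv l z0) \<le> 0"
      using boundary_contact[OF l _ z] by auto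
    define Q where "Q = (deriv D z0 + z0 * deriv (deriv D) z0) / deriv D z0"
    have "(D has_field_derivative deriv l z0 * (z0 * deriv D z0) + l z0 * (deriv D z0 + z0 * deriv (deriv D) z0)) (at z0)"
    proof (rule has_field_derivative_transform_within_open[OF _ open_ball z0(1)])
      show "((\<lambda>z. l z * (z * deriv D z)) has_field_derivative deriv l z0 * (z0 * deriv D z0) + l z0 * (deriv D z0 + z0 * deriv (deriv D) z0)) (at z0)"
        by (rule derivative_eq_intros holomorphic_derivI[OF l open_ball z0(1)] holomorphic_derivI[OF D' open_ball z0(1)] refl)+
           (simp add: algebra_simps)
    qed (simp add: eq)
    then have "deriv D z0 = deriv l z0 * (z0 * deriv D z0) + l z0 * (deriv D z0 + z0 * deriv (deriv D) z0)"
      by (rule DERIV_imp_deriv)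
    then have "1 = z0 * deriv l z0 + l z0 * Q"
      using nz[OF z0(1)] by (simp add: Q_def field_simps)
    then have "1 - z0 * deriv l z0 = l z0 * Q" by (simp add: algebra_simps)
    then have "Re (1 - z0 * deriv l z0) = Re (l z0 * Q)" "Im (1 - z0 * deriv l z0) = Im (l z0 * Q)"
      by simp_all
    moreover have "Re (l z0 * Q) = - Im (l z0) * Im Q" "Im (l z0 * Q) = Im (l z0) * Re Q"
      using z0(2) by simp_all
    moreover have "Re (1 - z0 * deriv l z0) = 1 - Re (z0 * deriv l z0)" "Im (1 - z0 * deriv l z0) = 0"
      using z0(3) unfolding minus_complex.sel by simp_all
    ultimately have "1 - Re (z0 * deriv l z0) = - Im (l z0) * Im Q" "0 = Im (l z0) * Re Q"
      by linarith+
    moreover have "0 < Re Q" unfolding Q_def by (rule P[OF z0(1)])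
    ultimately have "1 - Re (z0 * deriv l z0) = 0" by simp
    then show False using z0(4) by linarith
  qed
  then show ?thesis using that l eq by blast
qed

text \<open>For \<open>q = N / D\<close> one has \<open>N' / D' = q + z q' l\<close>, where \<open>l = D / (z D')\<close>. At a contact point of \<open>q\<close>
  the real part of the right-hand side is \<open>z q' Re l \<le> 0\<close>.\<close>

lemma quotient_from_derivatives:
  assumes N: "N holomorphic_on \<bbbD>" "N 0 = 0" and D: "D holomorphic_on \<bbbD>" "D 0 = 0"
    and nz: "\<And>z. z \<in> \<bbbD> \<Longrightarrow> deriv D z \<noteq> 0"
    and l: "l holomorphic_on \<bbbD>" "\<And>z. z \<in> \<bbbD> \<Longrightarrow> D z = l z * (z * deriv D z)" "\<And>z. z \<in> \<bbbD> \<Longrightarrow> 0 < Re (l z)"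
    and P: "\<And>z. z \<in> \<bbbD> \<Longrightarrow> 0 < Re (deriv N z / deriv D z)"
  obtains q where "q holomorphic_on \<bbbD>" "\<And>z. z \<in> \<bbbD> \<Longrightarrow> N z = q z * D z" "\<And>z. z \<in> \<bbbD> \<Longrightarrow> 0 < Re (q z)"
proof -
  obtain n where n: "n holomorphic_on \<bbbD>" "\<And>z. norm z < 1 \<Longrightarrow> N z = z * n z" "deriv N 0 = n 0"
    using Schwarz3[OF N] by blast
  obtain d where d: "d holomorphic_on \<bbbD>" "\<And>z. norm z < 1 \<Longrightarrow> D z = z * d z" "deriv D 0 = d 0"
    using Schwarz3[OF D] by blast
  have dnz: "d z \<noteq> 0" if "z \<in> \<bbbD>" for z
  proof (cases "z = 0")
    case False
    then show ?thesis using l(2,3)[OF that] d(2)[of z] nz[OF that] that by auto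
  qed (use d nz[of 0] in auto)
  define q where "q = (\<lambda>z. n z / d z)"
  have q: "q holomorphic_on \<bbbD>" unfolding q_def by (intro holomorphic_intros n d dnz)
  have eq: "N z = q z * D z" if "z \<in> \<bbbD>" for z
    using d(2)[of z] n(2)[of z] dnz[of z] that by (simp add: q_def)
  have "0 < Re (q z)" if z: "z \<in> \<bbbD>" for z
  proof (rule ccontr)
    assume "\<not> 0 < Re (q z)"
    moreover have "0 < Re (q 0)" using P[of 0] n(3) d(3) by (simp add: q_def)
    ultimately obtain z0 where z0: "z0 \<in> \<bbbD>" "Re (q z0) = 0" "Im (z0 * deriv q z0) = 0" "Re (z0 * deriv q z0) \<le> 0"
      using boundary_contact[OF q _ z] by auto
    have "(N has_field_derivative deriv q z0 * D z0 + q z0 * deriv D z0) (at z0)"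
    proof (rule has_field_derivative_transform_within_open[OF _ open_ball z0(1)])
      show "((\<lambda>z. q z * D z) has_field_derivative deriv q z0 * D z0 + q z0 * deriv D z0) (at z0)"
        by (rule derivative_eq_intros holomorphic_derivI[OF q open_ball z0(1)] holomorphic_derivI[OF D(1) open_ball z0(1)] refl)+
           (simp add: algebra_simps)
    qed (simp add: eq)
    then have "deriv N z0 = deriv q z0 * D z0 + q z0 * deriv D z0"
      by (rule DERIV_imp_deriv)
    then have "deriv N z0 = deriv q z0 * (l z0 * (z0 * deriv D z0)) + q z0 * deriv D z0"
      by (simp only: l(2)[OF z0(1), symmetric])
    then have "deriv N z0 / deriv D z0 = q z0 + (z0 * deriv q z0) * l z0"
      using nz[OF z0(1)] by (simp add: field_simps)
    then have "0 < Re (z0 * deriv q z0) * Re (l z0)"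
      using P[OF z0(1)] z0(2,3) by simp
    then show False using z0(4) l(3)[OF z0(1)] by (simp add: zero_less_mult_iff)
  qed
  then show ?thesis using that q eq by blast
qed


section \<open>Zeros of functions convex with respect to symmetric points\<close>

lemma deriv_symmetric_difference:
  assumes f: "f holomorphic_on \<bbbD>" and z: "z \<in> \<bbbD>"
  shows "((\<lambda>w. f w - f (- w)) has_field_derivative deriv f z + deriv f (- z)) (at z)"
proof -
  have mz: "- z \<in> \<bbbD>" using z by simp
  have "((\<lambda>w. f (- w)) has_field_derivative deriv f (- z) * (- 1)) (at z)"
    by (rule DERIV_chain2[of f]) (auto intro!: derivative_eq_intros holomorphic_derivI[OF f open_ball mz])
  from DERIV_diff[OF holomorphic_derivI[OF f open_ball z] this] show ?thesis by simp
qed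

lemma class_K_S_derivatives:
  assumes "f \<in> class_K_S"
  shows "f holomorphic_on \<bbbD>" "f 0 = 0" "deriv f 0 = 1"
    and "\<And>z. z \<in> \<bbbD> \<Longrightarrow> 0 < Re ((deriv f z + z * deriv (deriv f) z) / (deriv f z + deriv f (- z)))"
proof -
  show f: "f holomorphic_on \<bbbD>" and "f 0 = 0" "deriv f 0 = 1"
    using assms by (auto simp: class_K_S_def class_A_def)
  have f': "deriv f holomorphic_on \<bbbD>" by (intro holomorphic_deriv f) auto
  show "0 < Re ((deriv f z + z * deriv (deriv f) z) / (deriv f z + deriv f (- z)))" if z: "z \<in> \<bbbD>" for z
  proof -
    have "deriv (\<lambda>w. w * deriv f w) z = deriv f z + z * deriv (deriv f) z"
      by (rule DERIV_imp_deriv)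
         (auto intro!: derivative_eq_intros holomorphic_derivI[OF f' open_ball z])
    moreover have "deriv (\<lambda>w. f w - f (- w)) z = deriv f z + deriv f (- z)"
      by (rule DERIV_imp_deriv[OF deriv_symmetric_difference[OF f z]])
    moreover have "0 < Re (deriv (\<lambda>w. w * deriv f w) z / deriv (\<lambda>w. f w - f (- w)) z)"
      using assms z by (auto simp: class_K_S_def)
    ultimately show ?thesis by simp
  qed
qed

text \<open>The convexity of \<open>g(z) = f(z) - f(-z)\<close> comes from averaging the defining inequality over \<open>z\<close> and
  \<open>-z\<close>, as \<open>g'\<close> is even. Since \<open>(z f')'\<close> is compared with \<open>g'\<close>, the quotient \<open>q = z f' / g\<close> has
  positive real part. If \<open>G' = g / z\<close>, then \<open>(z G')' / G' = z g' / g\<close>, so \<open>G\<close> is convex because \<open>g\<close>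
  is starlike; and \<open>f' / G' = q\<close>, so \<open>f / G\<close> has positive real part too.\<close>

lemma class_K_S_nonzero:
  assumes "f \<in> class_K_S" and z: "z \<in> \<bbbD>" "z \<noteq> 0"
  shows "f z \<noteq> 0"
proof -
  note f = class_K_S_derivatives[OF assms(1)]
  have f': "deriv f holomorphic_on \<bbbD>" by (intro holomorphic_deriv f) auto
  have minus: "- z \<in> \<bbbD>" if "z \<in> \<bbbD>" for z :: complex using that by simp
  define p where "p z = (deriv f z + z * deriv (deriv f) z) / (deriv f z + deriv f (- z))" for z
  have p: "0 < Re (p z)" if "z \<in> \<bbbD>" for z using f(4)[OF that] by (simp add: p_def)
  define k where "k z = deriv f z + deriv f (- z)" for z
  have knz: "k z \<noteq> 0" if "z \<in> \<bbbD>" for z using p[OF that] by (auto simp: p_def k_def)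
  have keven: "k (- z) = k z" for z by (simp add: k_def)
  have hp: "deriv f z + z * deriv (deriv f) z = p z * k z" if "z \<in> \<bbbD>" for z
    using knz[OF that] by (simp add: p_def k_def)
  define g where "g z = f z - f (- z)" for z
  have g': "(g has_field_derivative k z) (at z)" if "z \<in> \<bbbD>" for z
    unfolding g_def k_def by (rule deriv_symmetric_difference[OF f(1) that])
  have dg: "deriv g z = k z" if "z \<in> \<bbbD>" for z by (rule DERIV_imp_deriv[OF g'[OF that]])
  have g: "g holomorphic_on \<bbbD>" using g' holomorphic_on_open by blast
  have g0: "g 0 = 0" by (simp add: g_def)
  have k': "(k has_field_derivative deriv (deriv f) z - deriv (deriv f) (- z)) (at z)" if z: "z \<in> \<bbbD>" for z
  proof -
    have "((\<lambda>w. deriv f (- w)) has_field_derivative deriv (deriv f) (- z) * (- 1)) (at z)"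
      by (rule DERIV_chain2[of "deriv f"])
         (auto intro!: derivative_eq_intros holomorphic_derivI[OF f' open_ball minus[OF z]])
    from DERIV_add[OF holomorphic_derivI[OF f' open_ball z] this] show ?thesis by (simp add: k_def[abs_def])
  qed
  have k: "k holomorphic_on \<bbbD>" using k' holomorphic_on_open by blast
  have ddg: "deriv (deriv g) z = deriv (deriv f) z - deriv (deriv f) (- z)" if z: "z \<in> \<bbbD>" for z
  proof -
    have "deriv (deriv g) z = deriv k z"
      by (rule deriv_cong_ev) (use z dg in \<open>auto intro!: exI[of _ "\<bbbD>"] simp: eventually_nhds\<close>)
    then show ?thesis using DERIV_imp_deriv[OF k'[OF z]] by simp
  qed
  have gconv: "0 < Re ((deriv g z + z * deriv (deriv g) z) / deriv g z)" if z: "z \<in> \<bbbD>" for z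
  proof -
    have "k z + z * (deriv (deriv f) z - deriv (deriv f) (- z)) = p z * k z + p (- z) * k z"
    proof -
      have "k z + z * (deriv (deriv f) z - deriv (deriv f) (- z))
          = (deriv f z + z * deriv (deriv f) z) + (deriv f (- z) + (- z) * deriv (deriv f) (- z))"
        by (simp add: k_def algebra_simps)
      then show ?thesis by (simp only: hp[OF z] hp[OF minus[OF z]] keven)
    qed
    then have "(deriv g z + z * deriv (deriv g) z) / deriv g z = p z + p (- z)"
      using knz[OF z] unfolding dg[OF z] ddg[OF z] by (simp add: add_divide_distrib)
    then show ?thesis using p[OF z] p[OF minus[OF z]] by simp
  qed
  obtain l where l: "l holomorphic_on \<bbbD>" "\<And>z. z \<in> \<bbbD> \<Longrightarrow> g z = l z * (z * deriv g z)"
    "\<And>z. z \<in> \<bbbD> \<Longrightarrow> 0 < Re (l z)"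
    using convex_imp_quotient_form[OF g g0 _ gconv] knz dg by auto
  define h where "h z = z * deriv f z" for z
  have h: "h holomorphic_on \<bbbD>" unfolding h_def by (intro holomorphic_intros f')
  have dh: "deriv h z = p z * k z" if z: "z \<in> \<bbbD>" for z
    unfolding h_def hp[OF that, symmetric]
    by (rule DERIV_imp_deriv)
       (auto intro!: derivative_eq_intros holomorphic_derivI[OF f' open_ball z])
  obtain q where q: "q holomorphic_on \<bbbD>" "\<And>z. z \<in> \<bbbD> \<Longrightarrow> h z = q z * g z" "\<And>z. z \<in> \<bbbD> \<Longrightarrow> 0 < Re (q z)"
    using quotient_from_derivatives[OF h _ g g0 _ l] knz dg dh p by (auto simp: h_def)
  \<comment> \<open>\<open>e(z) = g(z) / z\<close>, in a form that is visibly holomorphic and zero-free at the origin\<close>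
  define e where "e z = l z * k z" for z
  have e: "e holomorphic_on \<bbbD>" unfolding e_def by (intro holomorphic_intros l k)
  have lnz: "l z \<noteq> 0" if "z \<in> \<bbbD>" for z using l(3)[OF that] by auto
  have enz: "e z \<noteq> 0" if "z \<in> \<bbbD>" for z using lnz[OF that] knz[OF that] by (simp add: e_def)
  have ge: "g z = z * e z" if "z \<in> \<bbbD>" for z using l(2)[OF that] dg[OF that] by (simp add: e_def)
  obtain G0 where G0: "\<And>z. z \<in> \<bbbD> \<Longrightarrow> (G0 has_field_derivative e z) (at z within \<bbbD>)"
    using holomorphic_convex_primitive'[OF convex_ball open_ball e] by blast
  define G where "G z = G0 z - G0 0" for z
  have G': "(G has_field_derivative e z) (at z)" if "z \<in> \<bbbD>" for z
    using G0[OF that] that unfolding G_def by (auto intro!: derivative_eq_intros simp: at_within_open[OF _ open_ball])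
  have G: "G holomorphic_on \<bbbD>" using G' holomorphic_on_open by blast
  have dG: "deriv G z = e z" if "z \<in> \<bbbD>" for z by (rule DERIV_imp_deriv[OF G'[OF that]])
  have Gconv: "0 < Re ((deriv G z + z * deriv (deriv G) z) / deriv G z)" if z: "z \<in> \<bbbD>" for z
  proof -
    have "deriv (deriv G) z = deriv e z"
      by (rule deriv_cong_ev) (use z dG in \<open>auto intro!: exI[of _ "\<bbbD>"] simp: eventually_nhds\<close>)
    moreover have "deriv g z = e z + z * deriv e z"
    proof (rule DERIV_imp_deriv, rule has_field_derivative_transform_within_open[OF _ open_ball z])
      show "((\<lambda>z. z * e z) has_field_derivative e z + z * deriv e z) (at z)"
        by (auto intro!: derivative_eq_intros holomorphic_derivI[OF e open_ball z])
    qed (simp add: ge)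
    ultimately have "(deriv G z + z * deriv (deriv G) z) / deriv G z = k z / e z"
      using dG[OF z] dg[OF z] by simp
    also have "\<dots> = inverse (l z)" using knz[OF z] by (simp add: e_def field_simps)
    finally show ?thesis using l(3)[OF z] by (simp add: Re_complex_div_gt_0 inverse_eq_divide)
  qed
  have G0: "G 0 = 0" by (simp add: G_def)
  obtain m where m: "m holomorphic_on \<bbbD>" "\<And>z. z \<in> \<bbbD> \<Longrightarrow> G z = m z * (z * deriv G z)"
    "\<And>z. z \<in> \<bbbD> \<Longrightarrow> 0 < Re (m z)"
    using convex_imp_quotient_form[OF G G0 _ Gconv] enz dG by auto
  have "0 < Re (deriv f z / deriv G z)" if z: "z \<in> \<bbbD>" for z
  \<comment> \<open>The quotient is \<open>q\<close>; at the origin, where \<open>h = q g\<close> says nothing about \<open>q\<close>, it is \<open>1 / (2 l 0)\<close>.\<close>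
  proof (cases "z = 0")
    case True
    have "e 0 = l 0 * 2" by (simp add: e_def k_def f(3))
    then show ?thesis using l(3)[OF z] True dG[OF z] f(3) by (simp add: Re_complex_div_gt_0 inverse_eq_divide)
  next
    case False
    then have "deriv f z / deriv G z = q z"
      using q(2)[OF z] ge[OF z] enz[OF z] dG[OF z] by (simp add: h_def field_simps)
    then show ?thesis using q(3)[OF z] by simp
  qed
  then obtain r where r: "\<And>z. z \<in> \<bbbD> \<Longrightarrow> f z = r z * G z" "\<And>z. z \<in> \<bbbD> \<Longrightarrow> 0 < Re (r z)"
    using quotient_from_derivatives[OF f(1,2) G G0 _ m] enz dG by (metis (no_types, lifting))
  have "r z \<noteq> 0" "m z \<noteq> 0" using r(2)[OF z(1)] m(3)[OF z(1)] by auto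
  then show ?thesis using r(1)[OF z(1)] m(2)[OF z(1)] dG[OF z(1)] enz[OF z(1)] z(2) by simp
qed

section \<open>Schur parameters of the first four coefficients of a bounded function\<close>

lemma fps_eq_if_eq_on_disc:
  fixes f g :: "complex \<Rightarrow> complex"
  assumes F: "f has_fps_expansion F" and G: "g has_fps_expansion G"
    and eq: "\<And>z. z \<in> \<bbbD> \<Longrightarrow> f z = g z"
  shows "F = G"
proof -
  have "eventually (\<lambda>z. f z = g z) (nhds 0)"
    using eq by (auto simp: eventually_nhds intro!: exI[of _ "\<bbbD>"])
  then have "g has_fps_expansion F"
    using F has_fps_expansion_cong[of f g F F] by simp
  then show ?thesis using G by (rule fps_expansion_unique_complex)
qed

text \<open>This form of the maximum principle covers the degenerate case of the Schur algorithm, in which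
  the bounded function is a unimodular constant.\<close>

lemma bounded_by_attained_value_const:
  assumes f: "f holomorphic_on \<bbbD>" and bd: "\<And>z. z \<in> \<bbbD> \<Longrightarrow> norm (f z) \<le> 1"
    and w: "w \<in> \<bbbD>" "1 \<le> norm (f w)" and z: "z \<in> \<bbbD>"
  shows "f z = f w"
proof -
  have "norm (f y) \<le> norm (f w)" if "y \<in> \<bbbD>" for y
    using bd[OF that] w(2) by linarith
  then have "f constant_on \<bbbD>"
    by (intro maximum_modulus_principle[OF f open_ball connected_ball open_ball order_refl w(1)])
  then show ?thesis using w(1) z unfolding constant_on_def by metis
qed

text \<open>The Schwarz lemma under the non-strict bound \<open>|f| \<le> 1\<close>, as it is needed for iteration.\<close>

lemma bounded_quotient_by_z:
  assumes f: "f holomorphic_on \<bbbD>" "f 0 = 0" and bd: "\<And>z. z \<in> \<bbbD> \<Longrightarrow> norm (f z) \<le> 1"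
  obtains h where "h holomorphic_on \<bbbD>" "\<And>z. z \<in> \<bbbD> \<Longrightarrow> f z = z * h z" "\<And>z. z \<in> \<bbbD> \<Longrightarrow> norm (h z) \<le> 1"
proof -
  have strict: "norm (f z) < 1" if z: "norm z < 1" for z
  proof (rule ccontr)
    assume "\<not> norm (f z) < 1"
    then have "f 0 = f z"
      using z by (intro bounded_by_attained_value_const[OF f(1) bd]) auto
    then show False using f(2) \<open>\<not> norm (f z) < 1\<close> by simp
  qed
  obtain h where h: "h holomorphic_on \<bbbD>" "\<And>z. norm z < 1 \<Longrightarrow> f z = z * h z" "deriv f 0 = h 0"
    using Schwarz3[OF f] by blast
  have "norm (h z) \<le> 1" if z: "z \<in> \<bbbD>" for z
  proof (cases "z = 0")
    case True
    then show ?thesis using Schwarz_Lemma(2)[OF f strict, of 0] h(3) by simp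
  next
    case False
    then show ?thesis
      using Schwarz_Lemma(1)[OF f strict, of z] h(2)[of z] z by (simp add: norm_mult)
  qed
  then show ?thesis using that h by simp
qed

text \<open>The Schur algorithm replaces \<open>p\<close> by \<open>q(z) = (p(z) - p(0)) / (z (1 - cnj (p 0) p(z)))\<close>, which is
  bounded by 1 again: the Moebius map of the disc that moves \<open>p(0)\<close> to 0 is followed by the Schwarz
  lemma. Solving for \<open>p\<close> without denominators makes the relation meaningful also for
  \<open>|p(0)| = 1\<close>, where \<open>p\<close> is constant and \<open>q = 0\<close> will do.\<close>

lemma schur_step:
  assumes p: "p holomorphic_on \<bbbD>" and bd: "\<And>z. z \<in> \<bbbD> \<Longrightarrow> norm (p z) \<le> 1"
  obtains q where "q holomorphic_on \<bbbD>" "\<And>z. z \<in> \<bbbD> \<Longrightarrow> norm (q z) \<le> 1"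
    "\<And>z. z \<in> \<bbbD> \<Longrightarrow> p z * (1 + cnj (p 0) * (z * q z)) = p 0 + z * q z"
proof (cases "norm (p 0) < 1")
  case False
  then have const: "p z = p 0" if "z \<in> \<bbbD>" for z
    using that by (intro bounded_by_attained_value_const[OF p bd]) auto
  show ?thesis
  proof (rule that[of "\<lambda>_. 0"])
    show "p z * (1 + cnj (p 0) * (z * 0)) = p 0 + z * 0" if "z \<in> \<bbbD>" for z
      using const[OF that] by simp
  qed simp_all
next
  case True
  define a where "a = p 0"
  have nz: "1 - cnj a * p z \<noteq> 0" if "z \<in> \<bbbD>" for z
  proof
    assume "1 - cnj a * p z = 0"
    then have "norm a * norm (p z) = 1" by (metis complex_mod_cnj eq_iff_diff_eq_0 norm_mult norm_one)
    moreover have "norm a * norm (p z) \<le> norm a * 1"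
      by (intro mult_left_mono bd that) simp
    ultimately show False using True by (simp add: a_def)
  qed
  define F where "F z = (p z - a) / (1 - cnj a * p z)" for z
  have F: "F holomorphic_on \<bbbD>" unfolding F_def by (intro holomorphic_intros p nz)
  have F0: "F 0 = 0" by (simp add: F_def a_def)
  have bdF: "norm (F z) \<le> 1" if z: "z \<in> \<bbbD>" for z
  proof -
    have "(norm (1 - cnj a * p z))\<^sup>2 - (norm (p z - a))\<^sup>2 = (1 - (norm a)\<^sup>2) * (1 - (norm (p z))\<^sup>2)"
      unfolding cmod_power2 by (simp add: algebra_simps power2_eq_square)
    moreover have "(norm a)\<^sup>2 \<le> 1" "(norm (p z))\<^sup>2 \<le> 1"
      using True bd[OF z] by (auto simp: a_def power_le_one)
    ultimately have "(norm (p z - a))\<^sup>2 \<le> (norm (1 - cnj a * p z))\<^sup>2"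
      by (smt (verit) mult_nonneg_nonneg)
    then have "norm (p z - a) \<le> norm (1 - cnj a * p z)" by (rule power2_le_imp_le) simp
    then show ?thesis using nz[OF z] by (simp add: F_def norm_divide)
  qed
  obtain q where q: "q holomorphic_on \<bbbD>" "\<And>z. z \<in> \<bbbD> \<Longrightarrow> F z = z * q z" "\<And>z. z \<in> \<bbbD> \<Longrightarrow> norm (q z) \<le> 1"
    using bounded_quotient_by_z[OF F F0 bdF] by blast
  have "p z * (1 + cnj (p 0) * (z * q z)) = p 0 + z * q z" if z: "z \<in> \<bbbD>" for z
    using nz[OF z] unfolding q(2)[OF z, symmetric] a_def[symmetric] by (simp add: F_def field_simps)
  then show ?thesis using that q by blast
qed

text \<open>The relation of \<open>schur_step\<close> read off coefficientwise; it determines the coefficients of \<open>p\<close>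
  recursively from those of \<open>q\<close>.\<close>

lemma schur_step_coeffs:
  assumes p: "p holomorphic_on \<bbbD>" "\<And>z. z \<in> \<bbbD> \<Longrightarrow> norm (p z) \<le> 1" and P: "p has_fps_expansion P"
  obtains q Q where "q holomorphic_on \<bbbD>" "\<And>z. z \<in> \<bbbD> \<Longrightarrow> norm (q z) \<le> 1" "q has_fps_expansion Q"
    "\<And>n. fps_nth P (Suc n) = fps_nth Q n - cnj (fps_nth P 0) * fps_nth (P * Q) n"
proof -
  obtain q where q: "q holomorphic_on \<bbbD>" "\<And>z. z \<in> \<bbbD> \<Longrightarrow> norm (q z) \<le> 1"
    "\<And>z. z \<in> \<bbbD> \<Longrightarrow> p z * (1 + cnj (p 0) * (z * q z)) = p 0 + z * q z"
    using schur_step[OF p] by blast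
  define Q where "Q = fps_expansion q 0"
  have Q: "q has_fps_expansion Q"
    unfolding Q_def by (rule has_fps_expansion_fps_expansion[OF open_ball _ q(1)]) simp
  have p0: "p 0 = fps_nth P 0" by (simp add: has_fps_expansion_imp_0_eq_fps_nth_0[OF P])
  have "(\<lambda>z. p z * (1 + cnj (p 0) * (z * q z))) has_fps_expansion P * (1 + fps_const (cnj (p 0)) * (fps_X * Q))"
    by (intro fps_expansion_intros P Q)
  moreover have "(\<lambda>z. p 0 + z * q z) has_fps_expansion fps_const (p 0) + fps_X * Q"
    by (intro fps_expansion_intros Q)
  ultimately have eq: "P * (1 + fps_const (cnj (p 0)) * (fps_X * Q)) = fps_const (p 0) + fps_X * Q"
    using q(3) by (rule fps_eq_if_eq_on_disc)
  have "P + fps_const (cnj (p 0)) * (fps_X * (P * Q)) = fps_const (p 0) + fps_X * Q"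
    unfolding eq[symmetric] by (simp add: algebra_simps)
  then have "fps_nth (P + fps_const (cnj (p 0)) * (fps_X * (P * Q))) (Suc n) = fps_nth (fps_const (p 0) + fps_X * Q) (Suc n)" for n
    by simp
  then have "fps_nth P (Suc n) = fps_nth Q n - cnj (fps_nth P 0) * fps_nth (P * Q) n" for n
    by (simp add: p0 eq_diff_eq)
  then show ?thesis using that q Q by blast
qed

text \<open>The numbers \<open>a, b, c, d\<close> are the values at 0 of \<open>p\<close> and of its first three Schur transforms.\<close>

lemma bounded_coefficients:
  assumes p: "p holomorphic_on \<bbbD>" "\<And>z. z \<in> \<bbbD> \<Longrightarrow> norm (p z) \<le> 1" and P: "p has_fps_expansion P"
  obtains a b c d where "norm a \<le> 1" "norm b \<le> 1" "norm c \<le> 1" "norm d \<le> 1"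
    "fps_nth P 0 = a"
    "fps_nth P 1 = (1 - a * cnj a) * b"
    "fps_nth P 2 = (1 - a * cnj a) * ((1 - b * cnj b) * c - cnj a * b\<^sup>2)"
    "fps_nth P 3 = (1 - a * cnj a) * ((1 - b * cnj b) * ((1 - c * cnj c) * d - cnj b * c\<^sup>2 - 2 * cnj a * b * c)
                     + (cnj a)\<^sup>2 * b ^ 3)"
proof -
  obtain q Q where q: "q holomorphic_on \<bbbD>" "\<And>z. z \<in> \<bbbD> \<Longrightarrow> norm (q z) \<le> 1" "q has_fps_expansion Q"
    and PQ: "\<And>n. fps_nth P (Suc n) = fps_nth Q n - cnj (fps_nth P 0) * fps_nth (P * Q) n"
    using schur_step_coeffs[OF p P] by blast
  obtain r R where r: "r holomorphic_on \<bbbD>" "\<And>z. z \<in> \<bbbD> \<Longrightarrow> norm (r z) \<le> 1" "r has_fps_expansion R"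
    and QR: "\<And>n. fps_nth Q (Suc n) = fps_nth R n - cnj (fps_nth Q 0) * fps_nth (Q * R) n"
    using schur_step_coeffs[OF q] by blast
  obtain s S where s: "s holomorphic_on \<bbbD>" "\<And>z. z \<in> \<bbbD> \<Longrightarrow> norm (s z) \<le> 1" "s has_fps_expansion S"
    and RS: "\<And>n. fps_nth R (Suc n) = fps_nth S n - cnj (fps_nth R 0) * fps_nth (R * S) n"
    using schur_step_coeffs[OF r] by blast
  define a b c d where "a = fps_nth P 0" "b = fps_nth Q 0" "c = fps_nth R 0" "d = fps_nth S 0"
  note abcd = a_b_c_d_def
  have R1: "fps_nth R 1 = (1 - c * cnj c) * d"
    using RS[of 0] by (simp add: abcd algebra_simps)
  have Q1: "fps_nth Q 1 = (1 - b * cnj b) * c"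
    using QR[of 0] by (simp add: abcd algebra_simps)
  have Q2: "fps_nth Q 2 = (1 - b * cnj b) * ((1 - c * cnj c) * d - cnj b * c\<^sup>2)"
    using QR[of 1] R1 Q1 by (simp add: fps_mult_nth_1 numeral_2_eq_2 flip: abcd) (simp add: algebra_simps power2_eq_square)
  have P1: "fps_nth P 1 = (1 - a * cnj a) * b"
    using PQ[of 0] by (simp add: abcd algebra_simps)
  have P2: "fps_nth P 2 = (1 - a * cnj a) * ((1 - b * cnj b) * c - cnj a * b\<^sup>2)"
    using PQ[of 1] Q1 P1 by (simp add: fps_mult_nth_1 numeral_2_eq_2 flip: abcd) (simp add: algebra_simps power2_eq_square)
  have "fps_nth (P * Q) 2 = a * fps_nth Q 2 + fps_nth P 1 * fps_nth Q 1 + fps_nth P 2 * b"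
    by (simp add: fps_mult_nth numeral_2_eq_2 flip: abcd)
  then have P3: "fps_nth P 3 = (1 - a * cnj a) * ((1 - b * cnj b) * ((1 - c * cnj c) * d - cnj b * c\<^sup>2 - 2 * cnj a * b * c)
                     + (cnj a)\<^sup>2 * b ^ 3)"
    using PQ[of 2] unfolding Q2 Q1 P1 P2
    by (simp add: numeral_3_eq_3 numeral_2_eq_2 flip: abcd) (simp add: algebra_simps power2_eq_square power3_eq_cube)
  have "norm a \<le> 1" "norm b \<le> 1" "norm c \<le> 1" "norm d \<le> 1"
    using p(2)[of 0] q(2)[of 0] r(2)[of 0] s(2)[of 0]
      has_fps_expansion_imp_0_eq_fps_nth_0[OF P] has_fps_expansion_imp_0_eq_fps_nth_0[OF q(3)]
      has_fps_expansion_imp_0_eq_fps_nth_0[OF r(3)] has_fps_expansion_imp_0_eq_fps_nth_0[OF s(3)]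
    by (simp_all add: abcd)
  then show ?thesis using that P1 P2 P3 abcd(1) by blast
qed

section \<open>The extremal problem in Schur parameters\<close>

text \<open>Four times the Hankel determinant \<open>\<gamma>\<^sub>2 \<gamma>\<^sub>4 - \<gamma>\<^sub>3\<^sup>2\<close> of \<open>f\<close>, expressed by the Taylor coefficients
  \<open>u1, \<dots>, u4\<close> of the Schwarz function \<open>(p - 1) / (p + 1) = u1 z + u2 z\<^sup>2 + \<dots>\<close>. The two factors of
  the product are \<open>2 \<gamma>\<^sub>2\<close> and \<open>2 \<gamma>\<^sub>4\<close>, and \<open>2 \<gamma>\<^sub>3\<close> is squared.\<close>

definition hankel_schwarz :: "complex \<Rightarrow> complex \<Rightarrow> complex \<Rightarrow> complex \<Rightarrow> complex" where
  "hankel_schwarz u1 u2 u3 u4 =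
     (u2 / 3 + 5 / 24 * u1\<^sup>2) *
     (u4 / 10 + 11 / 80 * u1 * u3 + 13 / 90 * u2\<^sup>2 + 41 / 144 * u1\<^sup>2 * u2 + 251 / 2880 * u1 ^ 4)
     - (u3 / 8 + 5 / 24 * u1 * u2 + u1 ^ 3 / 8)\<^sup>2"

text \<open>The conjugates enter as independent variables \<open>a', b', c'\<close>, which makes this an identity of
  polynomials. All numerical coefficients in each of the four groups \<open>1, c, c\<^sup>2, d\<close> come out with the
  same sign, so that little is lost when the norms of the monomials are added up.\<close>

lemma hankel_schwarz_schur_form:
  fixes a b c d a' b' c' s r :: complex
  assumes s: "s = 1 - a * a'" and r: "r = 1 - b * b'"
  shows "hankel_schwarz a (s * b) (s * (r * c - a' * b\<^sup>2))
      (s * (r * ((1 - c * c') * d - b' * c\<^sup>2 - 2 * a' * b * c) + a'\<^sup>2 * b ^ 3)) =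
    (35 / 13824 * a ^ 6 + 209 / 5760 * a ^ 4 * s * b + 47 / 576 * a\<^sup>2 * s\<^sup>2 * b\<^sup>2
      + 1 / 384 * a ^ 3 * a' * s * b\<^sup>2 + 13 / 270 * s ^ 3 * b ^ 3 + 1 / 160 * a * a' * s\<^sup>2 * b ^ 3
      + 1 / 48 * a\<^sup>2 * a'\<^sup>2 * s * b ^ 3 + 17 / 960 * a'\<^sup>2 * s\<^sup>2 * b ^ 4)
    - (1 / 384 * a ^ 3 * s * r + 1 / 24 * a\<^sup>2 * a' * s * r * b + 1 / 160 * a * s\<^sup>2 * r * b
        + 17 / 480 * a' * s\<^sup>2 * r * b\<^sup>2) * c
    - ((1 / 30 * s * b + 1 / 48 * a\<^sup>2) * (s * r) * b' + 1 / 64 * s\<^sup>2 * r\<^sup>2) * c\<^sup>2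
    + ((1 / 30 * s * b + 1 / 48 * a\<^sup>2) * (s * r)) * ((1 - c * c') * d)"
  unfolding hankel_schwarz_def
  by (simp add: field_simps power2_eq_square power3_eq_cube power4_eq_xxxx eval_nat_numeral)

text \<open>Put \<open>A = x\<^sup>2\<close>, so that \<open>A + S = 1\<close>. The odd powers of \<open>x\<close> are removed by
  \<open>x \<le> (1 + x\<^sup>2) / 2 = A + S / 2\<close>. Then everything is made homogeneous of degree 3 in \<open>A\<close> and \<open>S\<close>,
  and is compared with \<open>13/270 (A + S)\<^sup>3\<close> coefficient by coefficient. Each comparison is an inequality
  in \<open>y\<close> alone; only the one for \<open>S\<^sup>3\<close> is tight, at \<open>y = 1\<close>, and there \<open>1 - y\<close> can be split off.\<close>

lemma schur_majorant_le:
  fixes x y S R :: real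
  assumes x: "0 \<le> x" "x \<le> 1" and y: "0 \<le> y" "y \<le> 1" and S: "S = 1 - x\<^sup>2" and R: "R = 1 - y\<^sup>2"
  shows "35 / 13824 * x ^ 6 + 209 / 5760 * x ^ 4 * S * y + 47 / 576 * x\<^sup>2 * S\<^sup>2 * y\<^sup>2
      + 1 / 384 * x ^ 4 * S * y\<^sup>2 + 13 / 270 * S ^ 3 * y ^ 3 + 1 / 160 * x\<^sup>2 * S\<^sup>2 * y ^ 3
      + 1 / 48 * x ^ 4 * S * y ^ 3 + 17 / 960 * x\<^sup>2 * S\<^sup>2 * y ^ 4
    + (1 / 384 * x ^ 3 * S * R + 1 / 24 * x ^ 3 * S * R * y + 1 / 160 * x * S\<^sup>2 * R * y
        + 17 / 480 * x * S\<^sup>2 * R * y\<^sup>2)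
    + ((1 / 30 * S * y + 1 / 48 * x\<^sup>2) * (S * R) + 1 / 64 * S\<^sup>2 * R\<^sup>2) \<le> 13 / 270"
    (is "?L \<le> _")
proof -
  define A where "A = x\<^sup>2"
  have A: "0 \<le> A" "A + S = 1" and S0: "0 \<le> S" and R0: "0 \<le> R" "R \<le> 1" "y\<^sup>2 + R = 1"
    using x y by (auto simp: A_def S R power_le_one)
  \<comment> \<open>\<open>p2\<close> and \<open>p3\<close> collect the coefficients of \<open>A\<^sup>2 S\<close> and \<open>A S\<^sup>2\<close> in the terms even in \<open>x\<close>; \<open>f1\<close> and \<open>f2\<close>
    those of \<open>x A S\<close> and \<open>x S\<^sup>2\<close> in the odd ones; \<open>f3\<close> comes from the part of degree 2 in \<open>A\<close> and \<open>S\<close>, which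
    is multiplied by \<open>A + S = 1\<close>.\<close>
  define f1 where "f1 = R / 384 + R * y / 24"
  define f2 where "f2 = R * y / 160 + 17 / 480 * (R * y\<^sup>2)"
  define f3 where "f3 = R * y / 30 + R\<^sup>2 / 64"
  have f: "0 \<le> f1" "0 \<le> f2" using R0 y by (simp_all add: f1_def f2_def)
  define p2 where "p2 = 209 / 5760 * y + y\<^sup>2 / 384 + y ^ 3 / 48"
  define p3 where "p3 = 47 / 576 * y\<^sup>2 + y ^ 3 / 160 + 17 / 960 * y ^ 4"
  have xle: "x \<le> A + S / 2"
  proof -
    have "0 \<le> (x - 1)\<^sup>2" by simp
    then show ?thesis unfolding A_def S by (simp add: power2_eq_square field_simps)
  qed
  have one: "(A + S) = 1" by (fact A(2))
  have "?L = 35 / 13824 * A ^ 3 + A\<^sup>2 * S * p2 + A * S\<^sup>2 * p3 + 13 / 270 * y ^ 3 * S ^ 3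
      + x * (A * S * f1 + S\<^sup>2 * f2) + (S\<^sup>2 * f3 + A * S * R / 48)"
    unfolding A_def p2_def p3_def f1_def f2_def f3_def
    by (simp add: field_simps power2_eq_square eval_nat_numeral)
  also have "\<dots> \<le> 35 / 13824 * A ^ 3 + A\<^sup>2 * S * p2 + A * S\<^sup>2 * p3 + 13 / 270 * y ^ 3 * S ^ 3
      + (A + S / 2) * (A * S * f1 + S\<^sup>2 * f2) + (S\<^sup>2 * f3 + A * S * R / 48)"
    using A S0 f xle by (intro add_mono mult_right_mono order_refl) simp_all
  also have "\<dots> = 35 / 13824 * A ^ 3 + A\<^sup>2 * S * p2 + A * S\<^sup>2 * p3 + 13 / 270 * y ^ 3 * S ^ 3
      + (A + S / 2) * (A * S * f1 + S\<^sup>2 * f2) + (S\<^sup>2 * f3 + A * S * R / 48) * (A + S)"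
    unfolding one by simp
  also have "\<dots> = A ^ 3 * (35 / 13824) + A\<^sup>2 * S * (p2 + f1 + R / 48)
      + A * S\<^sup>2 * (p3 + f1 / 2 + f2 + f3 + R / 48) + S ^ 3 * (13 / 270 * y ^ 3 + f2 / 2 + f3)"
    by (simp add: field_simps power2_eq_square power3_eq_cube)
  also have "\<dots> \<le> A ^ 3 * (13 / 270) + A\<^sup>2 * S * (13 / 90) + A * S\<^sup>2 * (13 / 90) + S ^ 3 * (13 / 270)"
  proof (intro add_mono mult_left_mono)
    have Ry: "R * y \<le> R" "R * y\<^sup>2 \<le> R" "R\<^sup>2 \<le> R"
      using R0 y by (simp_all add: mult_left_le power_le_one power2_eq_square)
    have ys: "y\<^sup>2 \<le> 1" "y ^ 3 \<le> y\<^sup>2" "y ^ 4 \<le> y\<^sup>2"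
      using y by (auto intro: power_decreasing power_le_one)
    show "p2 + f1 + R / 48 \<le> 13 / 90"
      unfolding p2_def f1_def using Ry ys y R0 by linarith
    show "p3 + f1 / 2 + f2 + f3 + R / 48 \<le> 13 / 90"
    proof -
      have "p3 \<le> 19 / 180 * y\<^sup>2" unfolding p3_def using ys by linarith
      moreover have "f1 \<le> 17 / 384 * R" unfolding f1_def using Ry by linarith
      moreover have "f2 \<le> 1 / 24 * R" unfolding f2_def using Ry by linarith
      moreover have "f3 \<le> 47 / 960 * R" unfolding f3_def using Ry by linarith
      ultimately show ?thesis using R0 by linarith
    qed
    have "13 / 270 - (13 / 270 * y ^ 3 + f2 / 2 + f3)
        = (1 - y) * (281 / 8640 - 17 / 4320 * y + 83 / 8640 * y\<^sup>2 - 1 / 480 * y ^ 3)"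
      unfolding f2_def f3_def R by (simp add: field_simps power2_eq_square power3_eq_cube)
    moreover have "0 \<le> (1 - y) * (281 / 8640 - 17 / 4320 * y + 83 / 8640 * y\<^sup>2 - 1 / 480 * y ^ 3)"
      using y ys zero_le_power2[of y] by (intro mult_nonneg_nonneg) (simp, linarith)
    ultimately show "13 / 270 * y ^ 3 + f2 / 2 + f3 \<le> 13 / 270" by linarith
  qed (use A S0 in auto)
  also have "\<dots> = 13 / 270 * (A + S) ^ 3"
    by (simp add: field_simps power2_eq_square power3_eq_cube)
  also have "\<dots> = 13 / 270" unfolding one by simp
  finally show ?thesis .
qed

text \<open>The parameter \<open>d\<close> occurs only with the factor \<open>1 - |c|\<^sup>2\<close>. Hence the terms with \<open>c\<^sup>2\<close> and \<open>d\<close> are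
  bounded by a convex combination, with weights \<open>|c|\<^sup>2\<close> and \<open>1 - |c|\<^sup>2\<close>, of two numbers that do not
  exceed \<open>B\<close>. In the linear term \<open>|c| \<le> 1\<close> is enough. What remains is \<open>schur_majorant_le\<close>.\<close>

lemma norm_hankel_schwarz_le:
  assumes a: "norm a \<le> 1" and b: "norm b \<le> 1" and c: "norm c \<le> 1" and d: "norm d \<le> 1"
  shows "norm (hankel_schwarz a ((1 - a * cnj a) * b)
      ((1 - a * cnj a) * ((1 - b * cnj b) * c - cnj a * b\<^sup>2))
      ((1 - a * cnj a) * ((1 - b * cnj b) * ((1 - c * cnj c) * d - cnj b * c\<^sup>2 - 2 * cnj a * b * c)
                     + (cnj a)\<^sup>2 * b ^ 3))) \<le> 13 / 270"
proof -
  define x y where "x = norm a" and "y = norm b"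
  define S R T where "S = 1 - x\<^sup>2" and "R = 1 - y\<^sup>2" and "T = 1 - (norm c)\<^sup>2"
  define s r where "s = 1 - a * cnj a" and "r = 1 - b * cnj b"
  have xy: "0 \<le> x" "x \<le> 1" "0 \<le> y" "y \<le> 1" using a b by (auto simp: x_def y_def)
  have SR: "0 \<le> S" "0 \<le> R" "0 \<le> T" using xy c by (auto simp: S_def R_def T_def power_le_one)
  have "s = of_real S" "r = of_real R" and cc: "1 - c * cnj c = of_real T"
    unfolding s_def r_def S_def R_def T_def x_def y_def of_real_diff of_real_1 complex_norm_square by simp_all
  then have ns: "norm s = S" "norm r = R" "norm (1 - c * cnj c) = T" using SR by simp_all
  note norms = norm_mult norm_power norm_divide ns complex_mod_cnj x_def[symmetric] y_def[symmetric]
  define C0 where "C0 = 35 / 13824 * a ^ 6 + 209 / 5760 * a ^ 4 * s * b + 47 / 576 * a\<^sup>2 * s\<^sup>2 * b\<^sup>2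
      + 1 / 384 * a ^ 3 * cnj a * s * b\<^sup>2 + 13 / 270 * s ^ 3 * b ^ 3 + 1 / 160 * a * cnj a * s\<^sup>2 * b ^ 3
      + 1 / 48 * a\<^sup>2 * (cnj a)\<^sup>2 * s * b ^ 3 + 17 / 960 * (cnj a)\<^sup>2 * s\<^sup>2 * b ^ 4"
  define C1 where "C1 = 1 / 384 * a ^ 3 * s * r + 1 / 24 * a\<^sup>2 * cnj a * s * r * b + 1 / 160 * a * s\<^sup>2 * r * b
        + 17 / 480 * cnj a * s\<^sup>2 * r * b\<^sup>2"
  define D where "D = (1 / 30 * s * b + 1 / 48 * a\<^sup>2) * (s * r)"
  define B0 where "B0 = 35 / 13824 * x ^ 6 + 209 / 5760 * x ^ 4 * S * y + 47 / 576 * x\<^sup>2 * S\<^sup>2 * y\<^sup>2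
      + 1 / 384 * x ^ 4 * S * y\<^sup>2 + 13 / 270 * S ^ 3 * y ^ 3 + 1 / 160 * x\<^sup>2 * S\<^sup>2 * y ^ 3
      + 1 / 48 * x ^ 4 * S * y ^ 3 + 17 / 960 * x\<^sup>2 * S\<^sup>2 * y ^ 4"
  define B1 where "B1 = 1 / 384 * x ^ 3 * S * R + 1 / 24 * x ^ 3 * S * R * y + 1 / 160 * x * S\<^sup>2 * R * y
        + 17 / 480 * x * S\<^sup>2 * R * y\<^sup>2"
  define BD where "BD = (1 / 30 * S * y + 1 / 48 * x\<^sup>2) * (S * R)"
  define B where "B = BD + 1 / 64 * S\<^sup>2 * R\<^sup>2"
  have C0: "norm C0 \<le> B0" unfolding C0_def B0_def
    by (intro norm_triangle_mono) (simp_all add: norms power2_eq_square eval_nat_numeral mult_ac)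
  have C1: "norm C1 \<le> B1" unfolding C1_def B1_def
    by (intro norm_triangle_mono) (simp_all add: norms power2_eq_square eval_nat_numeral mult_ac)
  have D: "norm D \<le> BD"
  proof -
    have "norm (1 / 30 * s * b + 1 / 48 * a\<^sup>2) \<le> 1 / 30 * S * y + 1 / 48 * x\<^sup>2"
      by (intro norm_triangle_mono) (simp_all add: norms)
    then show ?thesis unfolding D_def BD_def using SR by (simp add: norms mult_right_mono)
  qed
  have BD0: "0 \<le> BD" using SR xy by (simp add: BD_def)
  have B1_0: "0 \<le> B1" using SR xy by (simp add: B1_def)
  have C2: "norm (D * cnj b + 1 / 64 * s\<^sup>2 * r\<^sup>2) \<le> B" unfolding B_def
  proof (intro norm_triangle_mono)
    have "norm (D * cnj b) \<le> BD * 1"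
      unfolding norm_mult using D b BD0 by (intro mult_mono) auto
    then show "norm (D * cnj b) \<le> BD" by simp
  qed (simp add: norms)
  have t1: "norm (C1 * c) \<le> B1"
    using mult_mono[OF C1 c B1_0] by (simp add: norm_mult)
  have t2: "norm ((D * cnj b + 1 / 64 * s\<^sup>2 * r\<^sup>2) * c\<^sup>2) \<le> B * (norm c)\<^sup>2"
    using mult_right_mono[OF C2, of "(norm c)\<^sup>2"] by (simp add: norm_mult norm_power)
  have "norm (D * ((1 - c * cnj c) * d)) \<le> BD * (T * 1)"
    unfolding norm_mult[of D] norm_mult[of _ d] ns using D d SR BD0 by (intro mult_mono) auto
  also have "\<dots> \<le> B * T" unfolding B_def using SR by (simp add: mult_right_mono)
  finally have t3: "norm (D * ((1 - c * cnj c) * d)) \<le> B * T" .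
  have "norm (C0 - C1 * c - (D * cnj b + 1 / 64 * s\<^sup>2 * r\<^sup>2) * c\<^sup>2 + D * ((1 - c * cnj c) * d))
      \<le> B0 + B1 + B * (norm c)\<^sup>2 + B * T"
    by (intro norm_triangle_mono t3 order_trans[OF norm_triangle_ineq4] add_mono C0 t1 t2)
  also have "\<dots> = B0 + B1 + B" by (simp add: T_def algebra_simps)
  also have "\<dots> \<le> 13 / 270"
    using schur_majorant_le[OF xy S_def R_def] by (simp add: B0_def B1_def B_def BD_def)
  finally show ?thesis
    using hankel_schwarz_schur_form[OF s_def r_def, of c "cnj c" d]
    by (simp add: s_def[symmetric] r_def[symmetric] C0_def C1_def D_def)
qed

section \<open>Logarithmic coefficients through Taylor and Schwarz coefficients\<close>

text \<open>On the disc a zero-free function has a holomorphic logarithm; subtracting its value at 0 gives the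
  branch that vanishes there. So the choice in \<open>log_quotient\<close> is not void.\<close>

lemma is_log_quotient_log_quotient:
  assumes f: "f holomorphic_on \<bbbD>" "f 0 = 0" "deriv f 0 = 1"
    and nz: "\<forall>z\<in>\<bbbD> - {0}. f z \<noteq> 0"
  shows "is_log_quotient f (log_quotient f)"
proof -
  obtain h where h: "h holomorphic_on \<bbbD>" "\<And>z. norm z < 1 \<Longrightarrow> f z = z * h z" "deriv f 0 = h 0"
    using Schwarz3[OF f(1,2)] by blast
  have hnz: "h z \<noteq> 0" if "z \<in> \<bbbD>" for z
    using bspec[OF nz, of z] h(2)[of z] h(3) f(3) that by (cases "z = 0") auto
  obtain g where g: "g holomorphic_on \<bbbD>" "\<And>z. z \<in> \<bbbD> \<Longrightarrow> exp (g z) = h z"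
    using holomorphic_logarithm_exists[OF convex_ball open_ball h(1) hnz, of 0] by auto
  have "is_log_quotient f (\<lambda>z. g z - g 0)"
    unfolding is_log_quotient_def
  proof (intro conjI ballI)
    show "(\<lambda>z. g z - g 0) holomorphic_on \<bbbD>" by (intro holomorphic_intros g)
    fix z :: complex assume z: "z \<in> \<bbbD> - {0}"
    have "exp (g 0) = 1" using g(2)[of 0] h(3) f(3) by simp
    then show "exp (g z - g 0) = f z / z" using g(2)[of z] h(2)[of z] z by (simp add: exp_diff)
  qed simp
  then show ?thesis unfolding log_quotient_def by (rule someI[of "is_log_quotient f"])
qed

text \<open>With \<open>E = exp F = f / z\<close> the relation \<open>E' = E F'\<close> is a recursion for the coefficients of \<open>F\<close>, in
  which the coefficients of \<open>E\<close> are those of \<open>f\<close> with the index shifted by one.\<close>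

lemma log_coeff_from_taylor:
  assumes f: "f holomorphic_on \<bbbD>" "f 0 = 0" "deriv f 0 = 1"
    and nz: "\<forall>z\<in>\<bbbD> - {0}. f z \<noteq> 0"
    and A: "f has_fps_expansion A"
  defines "a \<equiv> fps_nth A"
  shows "2 * log_coeff f 2 = a 3 - (a 2)\<^sup>2 / 2"
    and "2 * log_coeff f 3 = a 4 - a 2 * a 3 + (a 2) ^ 3 / 3"
    and "2 * log_coeff f 4 = a 5 - a 2 * a 4 - (a 3)\<^sup>2 / 2 + (a 2)\<^sup>2 * a 3 - (a 2) ^ 4 / 4"
proof -
  define F where "F = log_quotient f"
  have F: "F holomorphic_on \<bbbD>" "F 0 = 0" "\<And>z. z \<in> \<bbbD> \<Longrightarrow> z \<noteq> 0 \<Longrightarrow> exp (F z) = f z / z"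
    using is_log_quotient_log_quotient[OF f nz] by (auto simp: is_log_quotient_def F_def)
  define E where "E z = exp (F z)" for z
  have E: "E holomorphic_on \<bbbD>" unfolding E_def by (intro holomorphic_intros F)
  define L U where "L = fps_expansion F 0" and "U = fps_expansion E 0"
  have L: "F has_fps_expansion L" and U: "E has_fps_expansion U"
    unfolding L_def U_def by (intro has_fps_expansion_fps_expansion[of \<bbbD>] F(1) E; simp)+
  have XU: "fps_X * U = A"
  proof (rule fps_eq_if_eq_on_disc[OF _ A])
    show "(\<lambda>z. z * E z) has_fps_expansion fps_X * U" by (intro fps_expansion_intros U)
    show "z * E z = f z" if "z \<in> \<bbbD>" for z
      using F(3)[OF that] f(2) by (cases "z = 0") (simp_all add: E_def)
  qed
  have dU: "fps_deriv U = U * fps_deriv L"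
  proof (rule fps_eq_if_eq_on_disc)
    show "deriv E has_fps_expansion fps_deriv U" by (intro fps_expansion_intros U)
    show "(\<lambda>z. E z * deriv F z) has_fps_expansion U * fps_deriv L" by (intro fps_expansion_intros U L)
    show "deriv E z = E z * deriv F z" if "z \<in> \<bbbD>" for z
      unfolding E_def
      by (rule DERIV_imp_deriv) (auto intro!: derivative_eq_intros holomorphic_derivI[OF F(1) open_ball that])
  qed
  have Ua: "fps_nth U n = a (Suc n)" for n unfolding a_def XU[symmetric] by simp
  have "E 0 = 1" using F(2) by (simp add: E_def)
  then have U0: "fps_nth U 0 = 1" using has_fps_expansion_imp_0_eq_fps_nth_0[OF U] by simp
  then have a1: "a 1 = 1" using Ua[of 0] by simp
  have rec: "of_nat (Suc n) * a (Suc (Suc n)) = fps_nth (U * fps_deriv L) n" for n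
    using arg_cong[OF dU, of "\<lambda>G. fps_nth G n"] by (simp add: Ua)
  define l where "l = fps_nth L"
  have e1: "l 1 = a 2"
    using rec[of 0] by (simp add: U0 l_def eval_nat_numeral)
  have e2: "2 * a 3 = 2 * l 2 + a 2 * l 1"
    using rec[of 1] a1 by (simp add: fps_mult_nth_1 Ua l_def eval_nat_numeral algebra_simps)
  have e3: "3 * a 4 = 3 * l 3 + 2 * (a 2 * l 2) + a 3 * l 1"
    using rec[of 2] a1 by (simp add: fps_mult_nth Ua l_def eval_nat_numeral algebra_simps)
  have e4: "4 * a 5 = 4 * l 4 + 3 * (a 2 * l 3) + 2 * (a 3 * l 2) + a 4 * l 1"
    using rec[of 3] a1 by (simp add: fps_mult_nth Ua l_def eval_nat_numeral algebra_simps)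
  have l: "2 * log_coeff f n = l n" for n by (simp add: log_coeff_def l_def L_def F_def)
  have l2: "l 2 = a 3 - (a 2)\<^sup>2 / 2" using e2 e1 by (simp add: field_simps power2_eq_square)
  have l3: "l 3 = a 4 - a 2 * a 3 + (a 2) ^ 3 / 3"
  proof -
    have "l 3 = a 4 - (2 * (a 2 * l 2) + a 3 * l 1) / 3" using e3 by (simp add: field_simps)
    also have "\<dots> = a 4 - a 2 * a 3 + (a 2) ^ 3 / 3"
      unfolding e1 l2 by (simp add: field_simps power2_eq_square power3_eq_cube)
    finally show ?thesis .
  qed
  have l4: "l 4 = a 5 - a 2 * a 4 - (a 3)\<^sup>2 / 2 + (a 2)\<^sup>2 * a 3 - (a 2) ^ 4 / 4"
  proof -
    have "l 4 = a 5 - (3 * (a 2 * l 3) + 2 * (a 3 * l 2) + a 4 * l 1) / 4" using e4 by (simp add: field_simps)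
    also have "\<dots> = a 5 - a 2 * a 4 - (a 3)\<^sup>2 / 2 + (a 2)\<^sup>2 * a 3 - (a 2) ^ 4 / 4"
      unfolding e1 l2 l3 by (simp add: field_simps power2_eq_square power3_eq_cube power4_eq_xxxx)
    finally show ?thesis .
  qed
  show "2 * log_coeff f 2 = a 3 - (a 2)\<^sup>2 / 2"
    and "2 * log_coeff f 3 = a 4 - a 2 * a 3 + (a 2) ^ 3 / 3"
    and "2 * log_coeff f 4 = a 5 - a 2 * a 4 - (a 3)\<^sup>2 / 2 + (a 2)\<^sup>2 * a 3 - (a 2) ^ 4 / 4"
    by (simp_all only: l l2 l3 l4)
qed

text \<open>Let \<open>h = 2 (z f')'\<close> and \<open>k(z) = f'(z) + f'(-z)\<close>. Positivity of \<open>Re (h / k)\<close> means \<open>|h - k| < |h + k|\<close>,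
  so \<open>(h - k) / (h + k)\<close> is a Schwarz function \<open>z p(z)\<close>. The four equations are the coefficients of
  \<open>z, \<dots>, z\<^sup>4\<close> in \<open>(h + k) z p = h - k\<close>; the \<open>n\<close>-th coefficient of \<open>k\<close> vanishes for odd \<open>n\<close>.\<close>

lemma class_K_S_taylor:
  assumes "f \<in> class_K_S" and A: "f has_fps_expansion A"
  defines "t \<equiv> fps_nth A"
  obtains p P where "p holomorphic_on \<bbbD>" "\<And>z. z \<in> \<bbbD> \<Longrightarrow> norm (p z) \<le> 1" "p has_fps_expansion P"
    "4 * t 2 = 2 * fps_nth P 0"
    "12 * t 3 = 4 * fps_nth P 1 + 8 * t 2 * fps_nth P 0"
    "32 * t 4 = 4 * fps_nth P 2 + 8 * t 2 * fps_nth P 1 + 24 * t 3 * fps_nth P 0"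
    "40 * t 5 = 4 * fps_nth P 3 + 8 * t 2 * fps_nth P 2 + 24 * t 3 * fps_nth P 1 + 32 * t 4 * fps_nth P 0"
proof -
  note f = class_K_S_derivatives[OF assms(1)]
  have f': "deriv f holomorphic_on \<bbbD>" by (intro holomorphic_deriv f) auto
  have f'': "deriv (deriv f) holomorphic_on \<bbbD>" by (intro holomorphic_deriv f') auto
  have fm: "(\<lambda>z. deriv f (- z)) holomorphic_on \<bbbD>"
    by (rule holomorphic_on_compose_gen[unfolded o_def, OF _ f']) (auto intro!: holomorphic_intros)
  define h k where "h z = 2 * (deriv f z + z * deriv (deriv f) z)" and "k z = deriv f z + deriv f (- z)" for z
  have hk: "h holomorphic_on \<bbbD>" "k holomorphic_on \<bbbD>"
    unfolding h_def k_def by (intro holomorphic_intros f' f'' fm)+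
  have pos: "0 < Re (h z / k z)" if "z \<in> \<bbbD>" for z
  proof -
    define v where "v = (deriv f z + z * deriv (deriv f) z) / (deriv f z + deriv f (- z))"
    have "h z / k z = 2 * v" by (simp only: v_def h_def k_def times_divide_eq_right)
    then show ?thesis using f(4)[OF that, folded v_def] by simp
  qed
  have knz: "k z \<noteq> 0" if "z \<in> \<bbbD>" for z using pos[OF that] by auto
  have lt: "norm (h z - k z) < norm (h z + k z)" if z: "z \<in> \<bbbD>" for z
  proof -
    define q where "q = h z / k z"
    have q: "0 < Re q" using pos[OF z] by (simp add: q_def)
    have "(norm (q - 1))\<^sup>2 < (norm (q + 1))\<^sup>2"
      unfolding cmod_power2 using q by (simp add: power2_eq_square algebra_simps)
    then have "norm (q - 1) < norm (q + 1)" by (rule power2_less_imp_less) simp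
    then have "norm (q - 1) * norm (k z) < norm (q + 1) * norm (k z)"
      using knz[OF z] by simp
    moreover have "(q - 1) * k z = h z - k z" "(q + 1) * k z = h z + k z"
      using knz[OF z] by (simp_all add: q_def algebra_simps)
    ultimately show ?thesis by (metis norm_mult)
  qed
  have nz: "h z + k z \<noteq> 0" if "z \<in> \<bbbD>" for z using lt[OF that] by auto
  define w where "w z = (h z - k z) / (h z + k z)" for z
  have w: "w holomorphic_on \<bbbD>" unfolding w_def by (intro holomorphic_intros hk nz)
  have w0: "w 0 = 0" by (simp add: w_def h_def k_def)
  have wbd: "norm (w z) \<le> 1" if "z \<in> \<bbbD>" for z
    using lt[OF that] nz[OF that] by (simp add: w_def norm_divide)
  obtain p where p: "p holomorphic_on \<bbbD>" "\<And>z. z \<in> \<bbbD> \<Longrightarrow> w z = z * p z" "\<And>z. z \<in> \<bbbD> \<Longrightarrow> norm (p z) \<le> 1"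
    using bounded_quotient_by_z[OF w w0 wbd] by blast
  define P where "P = fps_expansion p 0"
  have P: "p has_fps_expansion P"
    unfolding P_def by (rule has_fps_expansion_fps_expansion[OF open_ball _ p(1)]) simp
  define H where "H = 2 * (fps_deriv A + fps_X * fps_deriv (fps_deriv A))"
  define K where "K = fps_deriv A + fps_compose (fps_deriv A) (fps_const (- 1) * fps_X)"
  have H: "h has_fps_expansion H"
    unfolding h_def[abs_def] H_def by (intro fps_expansion_intros A)
  have K: "k has_fps_expansion K"
  proof -
    have "(\<lambda>z :: complex. - 1 * z) has_fps_expansion fps_const (- 1) * fps_X"
      by (intro fps_expansion_intros)
    then have "(deriv f \<circ> (\<lambda>z. - 1 * z)) has_fps_expansion fps_compose (fps_deriv A) (fps_const (- 1) * fps_X)"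
      by (intro has_fps_expansion_compose has_fps_expansion_deriv A) simp_all
    from has_fps_expansion_add[OF has_fps_expansion_deriv[OF A] this] show ?thesis
      by (simp add: K_def k_def[abs_def] o_def)
  qed
  have eq: "(H + K) * (fps_X * P) = H - K"
  proof (rule fps_eq_if_eq_on_disc)
    show "(\<lambda>z. (h z + k z) * (z * p z)) has_fps_expansion (H + K) * (fps_X * P)"
      by (intro fps_expansion_intros H K P)
    show "(\<lambda>z. h z - k z) has_fps_expansion H - K" by (intro fps_expansion_intros H K)
    show "(h z + k z) * (z * p z) = h z - k z" if "z \<in> \<bbbD>" for z
      using nz[OF that] by (simp add: p(2)[OF that, symmetric] w_def)
  qed
  have Hn: "fps_nth H n = 2 * of_nat (Suc n) * of_nat (Suc n) * t (Suc n)" for n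
    by (cases n) (simp_all add: H_def t_def numeral_fps_const algebra_simps)
  have Kn: "fps_nth K n = (1 + (- 1) ^ n) * of_nat (Suc n) * t (Suc n)" for n
    unfolding K_def fps_add_nth fps_nth_compose_linear by (simp add: t_def algebra_simps)
  have "fps_nth A 1 = deriv f 0"
    using fps_nth_fps_expansion[OF A, of 1] by simp
  then have t1: "t 1 = 1" using f(3) by (simp add: t_def)
  have rec: "fps_nth ((H + K) * P) n = fps_nth (H - K) (Suc n)" for n
    unfolding eq[symmetric] by (simp add: mult.left_commute[of _ fps_X])
  have n0: "fps_nth (H + K) 0 = 4" and n1: "fps_nth (H + K) 1 = 8 * t 2"
    and n2: "fps_nth (H + K) 2 = 24 * t 3" and n3: "fps_nth (H + K) 3 = 32 * t 4"
    and m1: "fps_nth (H - K) 1 = 8 * t 2" and m2: "fps_nth (H - K) 2 = 12 * t 3"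
    and m3: "fps_nth (H - K) 3 = 32 * t 4" and m4: "fps_nth (H - K) 4 = 40 * t 5"
    using t1 by (simp_all add: Hn Kn eval_nat_numeral)
  show ?thesis
  proof (rule that[OF p(1,3) P])
    show "4 * t 2 = 2 * fps_nth P 0"
      using rec[of 0] n0 m1 by (simp add: eval_nat_numeral)
    show "12 * t 3 = 4 * fps_nth P 1 + 8 * t 2 * fps_nth P 0"
      using rec[of 1] n0 n1 m2 by (simp add: fps_mult_nth_1 eval_nat_numeral)
    show "32 * t 4 = 4 * fps_nth P 2 + 8 * t 2 * fps_nth P 1 + 24 * t 3 * fps_nth P 0"
      using rec[of 2] n0 n1 n2 m3 by (simp add: fps_mult_nth eval_nat_numeral)
    show "40 * t 5 = 4 * fps_nth P 3 + 8 * t 2 * fps_nth P 2 + 24 * t 3 * fps_nth P 1 + 32 * t 4 * fps_nth P 0"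
      using rec[of 3] n0 n1 n2 n3 m4 by (simp add: fps_mult_nth eval_nat_numeral)
  qed
qed

lemma four_times_hankel_log_2_2:
  "4 * hankel_log_2_2 f = (2 * log_coeff f 2) * (2 * log_coeff f 4) - (2 * log_coeff f 3)\<^sup>2"
  by (simp add: hankel_log_2_2_def power2_eq_square algebra_simps)

lemma hankel_log_2_2_eq_hankel_schwarz:
  assumes f: "f \<in> class_K_S"
  obtains p P where "p holomorphic_on \<bbbD>" "\<And>z. z \<in> \<bbbD> \<Longrightarrow> norm (p z) \<le> 1" "p has_fps_expansion P"
    "4 * hankel_log_2_2 f = hankel_schwarz (fps_nth P 0) (fps_nth P 1) (fps_nth P 2) (fps_nth P 3)"
proof -
  note d = class_K_S_derivatives[OF f]
  define A where "A = fps_expansion f 0"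
  have A: "f has_fps_expansion A"
    unfolding A_def by (rule has_fps_expansion_fps_expansion[OF open_ball _ d(1)]) simp
  define t where "t = fps_nth A"
  obtain p P where p: "p holomorphic_on \<bbbD>" "\<And>z. z \<in> \<bbbD> \<Longrightarrow> norm (p z) \<le> 1" "p has_fps_expansion P"
    and e: "4 * t 2 = 2 * fps_nth P 0"
    "12 * t 3 = 4 * fps_nth P 1 + 8 * t 2 * fps_nth P 0"
    "32 * t 4 = 4 * fps_nth P 2 + 8 * t 2 * fps_nth P 1 + 24 * t 3 * fps_nth P 0"
    "40 * t 5 = 4 * fps_nth P 3 + 8 * t 2 * fps_nth P 2 + 24 * t 3 * fps_nth P 1 + 32 * t 4 * fps_nth P 0"
    using class_K_S_taylor[OF f A] unfolding t_def by blast
  have "\<forall>z\<in>\<bbbD> - {0}. f z \<noteq> 0" using class_K_S_nonzero[OF f] by blast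
  note lc = log_coeff_from_taylor[OF d(1,2,3) this A, folded t_def]
  define u1 u2 u3 u4 where "u1 = fps_nth P 0" "u2 = fps_nth P 1" "u3 = fps_nth P 2" "u4 = fps_nth P 3"
  note u = u1_u2_u3_u4_def
  have t2: "t 2 = u1 / 2" using e(1) by (simp add: u field_simps)
  have t3: "t 3 = (u2 + u1\<^sup>2) / 3"
  proof -
    have "t 3 = (4 * u2 + 8 * t 2 * u1) / 12"
      using e(2)[folded u] by (metis nonzero_mult_div_cancel_left zero_neq_numeral)
    also have "\<dots> = (u2 + u1\<^sup>2) / 3" unfolding t2 by (simp add: field_simps power2_eq_square)
    finally show ?thesis .
  qed
  have t4: "t 4 = (u3 + 3 * u1 * u2 + 2 * u1 ^ 3) / 8"
  proof -
    have "t 4 = (4 * u3 + 8 * t 2 * u2 + 24 * t 3 * u1) / 32"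
      using e(3)[folded u] by (metis nonzero_mult_div_cancel_left zero_neq_numeral)
    also have "\<dots> = (u3 + 3 * u1 * u2 + 2 * u1 ^ 3) / 8"
      unfolding t2 t3 by (simp add: field_simps power2_eq_square power3_eq_cube)
    finally show ?thesis .
  qed
  have t5: "t 5 = (u4 + 2 * u1 * u3 + 2 * u2\<^sup>2 + 5 * u1\<^sup>2 * u2 + 2 * u1 ^ 4) / 10"
  proof -
    have "t 5 = (4 * u4 + 8 * t 2 * u3 + 24 * t 3 * u2 + 32 * t 4 * u1) / 40"
      using e(4)[folded u] by (metis nonzero_mult_div_cancel_left zero_neq_numeral)
    also have "\<dots> = (u4 + 2 * u1 * u3 + 2 * u2\<^sup>2 + 5 * u1\<^sup>2 * u2 + 2 * u1 ^ 4) / 10"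
      unfolding t2 t3 t4 by (simp add: field_simps power2_eq_square power3_eq_cube power4_eq_xxxx)
    finally show ?thesis .
  qed
  have l2: "2 * log_coeff f 2 = u2 / 3 + 5 / 24 * u1\<^sup>2"
    unfolding lc t2 t3 by (simp add: field_simps power2_eq_square)
  have l3: "2 * log_coeff f 3 = u3 / 8 + 5 / 24 * u1 * u2 + u1 ^ 3 / 8"
    unfolding lc t2 t3 t4 by (simp add: field_simps power2_eq_square power3_eq_cube)
  have l4: "2 * log_coeff f 4 = u4 / 10 + 11 / 80 * u1 * u3 + 13 / 90 * u2\<^sup>2 + 41 / 144 * u1\<^sup>2 * u2 + 251 / 2880 * u1 ^ 4"
    unfolding lc t2 t3 t4 t5 by (simp add: field_simps power2_eq_square power3_eq_cube power4_eq_xxxx)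
  have "4 * hankel_log_2_2 f = hankel_schwarz u1 u2 u3 u4"
    unfolding four_times_hankel_log_2_2 l2 l3 l4 hankel_schwarz_def ..
  then show ?thesis using that[OF p] by (simp add: u)
qed


section \<open>The extremal function\<close>

text \<open>The inverse hyperbolic tangent, written with principal logarithms of \<open>1 + z\<close> and \<open>1 - z\<close>. These are
  holomorphic on the whole disc, where both arguments lie in the right half-plane.\<close>

definition artanh_disc :: "complex \<Rightarrow> complex" where
  "artanh_disc z = (Ln (1 + z) - Ln (1 - z)) / 2"

lemma disc_pm_nonpos:
  assumes "z \<in> \<bbbD>"
  shows "1 + z \<notin> \<real>\<^sub>\<le>\<^sub>0" "1 - z \<notin> \<real>\<^sub>\<le>\<^sub>0" "1 - z\<^sup>2 \<noteq> 0"
proof -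
  have "\<bar>Re z\<bar> < 1" using assms abs_Re_le_cmod[of z] by simp
  then show 1: "1 + z \<notin> \<real>\<^sub>\<le>\<^sub>0" "1 - z \<notin> \<real>\<^sub>\<le>\<^sub>0"
    by (auto simp: complex_nonpos_Reals_iff)
  then have "1 + z \<noteq> 0" "1 - z \<noteq> 0" by (metis nonpos_Reals_zero_I)+
  moreover have "1 - z\<^sup>2 = (1 + z) * (1 - z)" by (simp add: algebra_simps power2_eq_square)
  ultimately show "1 - z\<^sup>2 \<noteq> 0" by simp
qed

lemma artanh_disc_deriv:
  assumes z: "z \<in> \<bbbD>"
  shows "(artanh_disc has_field_derivative 1 / (1 - z\<^sup>2)) (at z)"
proof -
  note nz = disc_pm_nonpos[OF z]
  have "1 + z \<noteq> 0" "1 - z \<noteq> 0" using nz by auto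
  then have "(1 / (1 + z) + 1 / (1 - z)) / 2 = 1 / (1 - z\<^sup>2)"
    using nz(3) by (simp add: divide_simps) (simp add: algebra_simps power2_eq_square)
  moreover have "((\<lambda>w. Ln (1 + w)) has_field_derivative 1 / (1 + z)) (at z)"
    "((\<lambda>w. Ln (1 - w)) has_field_derivative - (1 / (1 - z))) (at z)"
    using nz by (auto intro!: derivative_eq_intros simp: divide_inverse)
  from DERIV_cdivide[OF DERIV_diff[OF this], of 2]
  have "(artanh_disc has_field_derivative (1 / (1 + z) + 1 / (1 - z)) / 2) (at z)"
    by (simp add: artanh_disc_def[abs_def])
  ultimately show ?thesis by (simp only:)
qed

text \<open>Here \<open>f'(z) = 1 / (1 - z\<^sup>2)\<close>, and the quotient in the definition of the class equals
  \<open>(1 + z\<^sup>2) / (2 (1 - z\<^sup>2))\<close>, a map into the right half-plane.\<close>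

lemma artanh_disc_in_class_K_S: "artanh_disc \<in> class_K_S"
proof -
  have hol: "artanh_disc holomorphic_on \<bbbD>" using artanh_disc_deriv holomorphic_on_open by blast
  have d: "deriv artanh_disc z = 1 / (1 - z\<^sup>2)" if "z \<in> \<bbbD>" for z
    by (rule DERIV_imp_deriv[OF artanh_disc_deriv[OF that]])
  have "0 < Re (deriv (\<lambda>w. w * deriv artanh_disc w) z / deriv (\<lambda>w. artanh_disc w - artanh_disc (- w)) z)"
    if z: "z \<in> \<bbbD>" for z
  proof -
    note nz = disc_pm_nonpos(3)[OF z]
    have "((\<lambda>w. w * deriv artanh_disc w) has_field_derivative (1 + z\<^sup>2) / (1 - z\<^sup>2)\<^sup>2) (at z)"
    proof (rule has_field_derivative_transform_within_open[OF _ open_ball z])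
      have "((\<lambda>w. 1 - w\<^sup>2) has_field_derivative - 2 * z) (at z)"
        by (auto intro!: derivative_eq_intros)
      from DERIV_divide[OF DERIV_ident this nz]
      show "((\<lambda>w. w / (1 - w\<^sup>2)) has_field_derivative (1 + z\<^sup>2) / (1 - z\<^sup>2)\<^sup>2) (at z)"
        by (simp add: power2_eq_square algebra_simps)
    qed (simp add: d)
    then have n: "deriv (\<lambda>w. w * deriv artanh_disc w) z = (1 + z\<^sup>2) / (1 - z\<^sup>2)\<^sup>2"
      by (rule DERIV_imp_deriv)
    have k: "deriv (\<lambda>w. artanh_disc w - artanh_disc (- w)) z = 2 / (1 - z\<^sup>2)"
      using DERIV_imp_deriv[OF deriv_symmetric_difference[OF hol z]] d[OF z] d[of "- z"] z by simp
    have "norm (z\<^sup>2) < 1" using z by (simp add: norm_power power_less_one_iff abs_square_less_1)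
    then have "(norm (z\<^sup>2))\<^sup>2 < 1" by (simp add: abs_square_less_1)
    moreover have "Re ((1 + z\<^sup>2) * cnj (1 - z\<^sup>2)) = 1 - (norm (z\<^sup>2))\<^sup>2"
      unfolding cmod_power2 by (simp add: algebra_simps power2_eq_square)
    ultimately have "0 < Re ((1 + z\<^sup>2) / (1 - z\<^sup>2))" by (simp add: Re_complex_div_gt_0)
    moreover have "(1 + z\<^sup>2) / (1 - z\<^sup>2)\<^sup>2 / (2 / (1 - z\<^sup>2)) = (1 + z\<^sup>2) / (1 - z\<^sup>2) / 2"
    proof -
      have "x / y\<^sup>2 / (2 / y) = x / y / 2" if "y \<noteq> 0" for x y :: complex
        using that by (simp add: power2_eq_square)
      then show ?thesis using nz by blast
    qed
    ultimately show ?thesis unfolding n k by (simp only: Re_divide_numeral half_gt_zero_iff)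
  qed
  moreover have "artanh_disc 0 = 0" "deriv artanh_disc 0 = 1" using d[of 0] by (simp_all add: artanh_disc_def)
  ultimately show ?thesis using hol by (simp add: class_K_S_def class_A_def)
qed

text \<open>The function is \<open>z + z\<^sup>3 / 3 + z\<^sup>5 / 5 + \<dots>\<close>; its coefficients are obtained from
  \<open>f' (1 - z\<^sup>2) = 1\<close>. Then \<open>\<gamma>\<^sub>3 = 0\<close>, and the determinant is the product \<open>\<gamma>\<^sub>2 \<gamma>\<^sub>4 = 1/6 \<cdot> 13/180\<close>.\<close>

lemma hankel_log_2_2_artanh_disc: "hankel_log_2_2 artanh_disc = 13 / 1080"
proof -
  note f = artanh_disc_in_class_K_S
  note d = class_K_S_derivatives[OF f]
  define A where "A = fps_expansion artanh_disc 0"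
  have A: "artanh_disc has_fps_expansion A"
    unfolding A_def by (rule has_fps_expansion_fps_expansion[OF open_ball _ d(1)]) simp
  have "\<forall>z\<in>\<bbbD> - {0}. artanh_disc z \<noteq> 0" using class_K_S_nonzero[OF f] by blast
  note lc = log_coeff_from_taylor[OF d(1,2,3) this A]
  have eq: "fps_deriv A * (1 - fps_X ^ 2) = 1"
  proof (rule fps_eq_if_eq_on_disc)
    show "(\<lambda>z. deriv artanh_disc z * (1 - z ^ 2)) has_fps_expansion fps_deriv A * (1 - fps_X ^ 2)"
      by (intro fps_expansion_intros A)
    show "(\<lambda>_. 1) has_fps_expansion (1 :: complex fps)" by (rule has_fps_expansion_1)
    show "deriv artanh_disc z * (1 - z ^ 2) = 1" if "z \<in> \<bbbD>" for z
      using disc_pm_nonpos(3)[OF that] DERIV_imp_deriv[OF artanh_disc_deriv[OF that]] by simp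
  qed
  have rec: "of_nat (Suc n) * fps_nth A (Suc n)
      = (if n = 0 then 1 else 0) + (if n < 2 then 0 else of_nat (Suc (n - 2)) * fps_nth A (Suc (n - 2)))" for n
    using arg_cong[OF eq, of "\<lambda>G. fps_nth G n"]
    by (simp add: right_diff_distrib fps_X_power_mult_right_nth fps_one_nth del: of_nat_Suc split: if_splits)
  have "fps_nth A 1 = 1" "fps_nth A 2 = 0" "3 * fps_nth A 3 = fps_nth A 1"
    "4 * fps_nth A 4 = 2 * fps_nth A 2" "5 * fps_nth A 5 = 3 * fps_nth A 3"
    using rec[of 0] rec[of 1] rec[of 2] rec[of 3] rec[of 4] by (simp_all add: eval_nat_numeral)
  then have nthA: "fps_nth A 2 = 0" "fps_nth A 3 = 1 / 3" "fps_nth A 4 = 0" "fps_nth A 5 = 1 / 5"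
    by (simp_all add: field_simps)
  have "4 * hankel_log_2_2 artanh_disc = 13 / 270"
    unfolding four_times_hankel_log_2_2 lc nthA by (simp add: power2_eq_square)
  also have "\<dots> = 4 * (13 / 1080)" by simp
  finally show ?thesis by (metis mult_left_cancel zero_neq_numeral)
qed


section \<open>The sharp bound\<close>

theorem theorem2p2:
  shows "(\<forall>f \<in> class_K_S. norm (hankel_log_2_2 f) \<le> 13 / 1080) \<and>
         (\<exists>f \<in> class_K_S. norm (hankel_log_2_2 f) = 13 / 1080)"
proof (intro conjI ballI bexI)
  fix f assume "f \<in> class_K_S"
  then obtain p P where p: "p holomorphic_on \<bbbD>" "\<And>z. z \<in> \<bbbD> \<Longrightarrow> norm (p z) \<le> 1" "p has_fps_expansion P"
    and eq: "4 * hankel_log_2_2 f = hankel_schwarz (fps_nth P 0) (fps_nth P 1) (fps_nth P 2) (fps_nth P 3)"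
    using hankel_log_2_2_eq_hankel_schwarz by blast
  obtain a b c d where "norm a \<le> 1" "norm b \<le> 1" "norm c \<le> 1" "norm d \<le> 1"
    and coeffs: "fps_nth P 0 = a"
    "fps_nth P 1 = (1 - a * cnj a) * b"
    "fps_nth P 2 = (1 - a * cnj a) * ((1 - b * cnj b) * c - cnj a * b\<^sup>2)"
    "fps_nth P 3 = (1 - a * cnj a) * ((1 - b * cnj b) * ((1 - c * cnj c) * d - cnj b * c\<^sup>2 - 2 * cnj a * b * c)
                     + (cnj a)\<^sup>2 * b ^ 3)"
    by (rule bounded_coefficients[OF p])
  then have "norm (4 * hankel_log_2_2 f) \<le> 13 / 270"
    unfolding eq coeffs by (intro norm_hankel_schwarz_le)
  then show "norm (hankel_log_2_2 f) \<le> 13 / 1080" by (simp add: norm_mult)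
next
  show "norm (hankel_log_2_2 artanh_disc) = 13 / 1080"
    by (simp add: hankel_log_2_2_artanh_disc)
qed (rule artanh_disc_in_class_K_S)

end
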